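(* Let $X$ be a topological space, $T:X\to X$ a continuous map, and $g$ a generator of a compact topological group $G$. Assume that there is a non-empty subset $Y$ of $\mathcal{U}(T)$ such that $T(Y)\subseteq Y$ and $Y$ (with the subspace topology) is path connected, locally path connected and simply connected. Then for every $x\in Y$ the set $\{(T^nx,g^n):n\in\mathbb{Z}_+\}$ is dense in $X\times G$.
   Context: All topological spaces (including topological groups) are assumed Hausdorff. $\mathbb{Z}_+$ is the set of non-negative integers, $\mathbb{T}=\{z\in\mathbb{C}:|z|=1\}$. For a continuous map $T:X\to X$, $\mathcal{U}(T)$ denotes the set of universal elements for $T$, i.e. of those $x\in X$ whose orbit $O(T,x)=\{T^nx:n\in\mathbb{Z}_+\}$ is dense in $X$. An element $g$ of a topological group $G$ is a generator of $G$ if $\{g^n:n\in\mathbb{Z}_+\}$ is dense in $G$. A space $Y$ is path connected if for all $x,y\in Y$ there is a continuous $f:[0,1]\to Y$ with $f(0)=x$, $f(1)=y$; locally path connected if it has a base of topology consisting of path connected sets (equivalently, for each $x\in Y$ and each neighborhood $U$ of $x$ there is a neighborhood $V$ of $x$ such that each $y\in V$ can be joined to $x$ by a continuous path contained in $U$); simply connected if for every continuous $f:\mathbb{T}\to Y$ there exist a continuous $F:\mathbb{T}\times[0,1]\to Y$ and $x_0\in Y$ with $F(z,0)=f(z)$ and $F(z,1)=x_0$ for all $z\in\mathbb{T}$. *)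

theory Defs
  imports "HOL-Analysis.Analysis" "HOL-Algebra.Group"
begin

locale topological_group = group G for G (structure) +
  fixes \<T> :: "'a topology"
  assumes topspace_eq_carrier: "topspace \<T> = carrier G"
    and continuous_mult:
      "continuous_map (prod_topology \<T> \<T>) \<T> (\<lambda>(x, y). x \<otimes> y)"
    and continuous_inv: "continuous_map \<T> \<T> (\<lambda>x. inv x)"

definition dense_in :: "'a topology \<Rightarrow> 'a set \<Rightarrow> bool" where
  "dense_in X S \<longleftrightarrow> S \<subseteq> topspace X \<and> X closure_of S = topspace X"

definition orbit_of :: "('a \<Rightarrow> 'a) \<Rightarrow> 'a \<Rightarrow> 'a set" where
  "orbit_of T x = {(T ^^ n) x | n :: nat. True}"

definition universal_elements :: "'a topology \<Rightarrow> ('a \<Rightarrow> 'a) \<Rightarrow> 'a set" where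
  "universal_elements X T = {x \<in> topspace X. dense_in X (orbit_of T x)}"

text \<open>Only non-negative powers are used.\<close>

definition topological_generator ::
    "('a, 'b) monoid_scheme \<Rightarrow> 'a topology \<Rightarrow> 'a \<Rightarrow> bool" where
  "topological_generator G \<T> g \<longleftrightarrow>
     g \<in> carrier G \<and> dense_in \<T> {g [^]\<^bsub>G\<^esub> n | n :: nat. True}"

text \<open>
  The library constant \<^const>\<open>simply_connected\<close> is restricted to subsets of a type with a
  type-class topology and has path connectedness built in. Here every continuous map from the
  unit circle is only required to be freely homotopic to a constant, for an abstract topology.
\<close>

definition simply_connected_space :: "'a topology \<Rightarrow> bool" where
  "simply_connected_space Y \<longleftrightarrow>
     (\<forall>f. continuous_map (top_of_set (sphere (0 :: complex) 1)) Y f \<longrightarrow>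
       (\<exists>F. \<exists>x0 \<in> topspace Y.
          continuous_map
            (prod_topology (top_of_set (sphere (0 :: complex) 1)) (top_of_set {0 .. 1 :: real}))
            Y F \<and>
          (\<forall>z \<in> sphere 0 1. F (z, 0) = f z \<and> F (z, 1) = x0)))"

end

theory Submission
  imports Defs
begin

text \<open>
  Let $C_x$ be the closure of the orbit of $(x, 1)$ under $T \times g$, and let $H$ be the fibre of $C_x$
  over $x$. By compactness every fibre of $C_x$ over $Y$ is nonempty; hence $H$ is a closed subgroup,
  the fibres over points of $Y$ are left cosets of $H$, and density follows once $g \in H$. If
  $g \notin H$, there are $\mu \neq 1$ and a continuous nowhere vanishing $h : G \to \mathbb{C}$ with
  $h(gx) = \mu h(x)$ that is constant on the left cosets of $H$; so $f(y) = h(\mbox{fibre over } y)$ is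
  continuous and nowhere zero on $Y$ and $f \circ T = \mu f$. As $Y$ is simply connected, $f$ has a
  logarithm, which $T$ shifts by a constant $c \neq 0$; this contradicts the recurrence of $x$.

  The eigenfunction $h$ is obtained without Haar measure or the Peter--Weyl theorem: for a continuous
  right $H$-invariant $u$ with $u(1) \neq u(g)$, the averages $\frac{1}{2N} \sum_{l < 2N} u(g^l x) z^l$
  satisfy the eigenvalue equation with $\mu = z^{-1}$ up to $O(1/N)$. Since $g^n$ returns to
  neighbourhoods of $1$ along a syndetic set of $n$, discrete Fourier analysis provides $z$ for which
  neither the average at $1$ nor $z - 1$ is small, uniformly in $N$; then pass to a limit.
\<close>

section \<open>Large exponential sums\<close>

text \<open>Each summand is \<open>r ^ k\<close> for the \<open>M\<close>-th root of unity
  \<open>r\<close> of angle \<open>2 * pi * (a - b) / M\<close>. Since |a - b| < M,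
  \<open>r = 1\<close> forces \<open>a = b\<close>; otherwise the geometric sum vanishes.\<close>

lemma sum_roots_of_unity_orthogonal:
  fixes M a b :: nat
  assumes "a < M" "b < M"
  shows "(\<Sum>k<M. cis (2 * pi * k / M) ^ a * cnj (cis (2 * pi * k / M)) ^ b) =
    (if a = b then of_nat M else 0)"
proof -
  define r where "r = cis (2 * pi * (real a - real b) / M)"
  have eq: "cis (2 * pi * k / M) ^ a * cnj (cis (2 * pi * k / M)) ^ b = r ^ k" for k :: nat
  proof -
    have "cis (2 * pi * k / M) ^ a * cnj (cis (2 * pi * k / M)) ^ b =
        cis (a * (2 * pi * k / M)) * cis (b * (- (2 * pi * k / M)))"
      by (simp only: cis_cnj Complex.DeMoivre)
    also have "\<dots> = cis (k * (2 * pi * (real a - real b) / M))"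
      unfolding cis_mult by (rule arg_cong[where f=cis]) (simp add: algebra_simps diff_divide_distrib)
    finally show ?thesis by (simp only: r_def Complex.DeMoivre)
  qed
  show ?thesis
  proof (cases "a = b")
    case True
    then show ?thesis unfolding eq by (simp add: r_def)
  next
    case False
    have "r ^ M = cis (2 * pi * (real a - real b))"
      using assms by (simp add: r_def Complex.DeMoivre)
    also have "\<dots> = 1"
      using cis_multiple_2pi[of "real a - real b"] by simp
    finally have rM: "r ^ M = 1" .
    have "r \<noteq> 1"
    proof
      assume "r = 1"
      then obtain n :: int where n: "2 * pi * (real a - real b) / M = 2 * pi * n"
        unfolding r_def cis_conv_exp exp_eq_1 by auto
      then have "real a - real b = n * M"
        using assms by (simp add: divide_eq_eq mult.assoc)
      then have "int a - int b = n * int M"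
        by (metis of_int_diff of_int_eq_iff of_int_mult of_int_of_nat_eq)
      moreover have "\<bar>int a - int b\<bar> < int M" using assms by auto
      ultimately have "\<bar>n\<bar> * int M < 1 * int M" by (simp add: abs_mult)
      then have "n = 0" using mult_less_cancel_right_pos[of "int M" "\<bar>n\<bar>" 1] assms by simp
      then show False using False \<open>int a - int b = n * int M\<close> by simp
    qed
    then show ?thesis using rM False unfolding eq by (simp add: geometric_sum)
  qed
qed

text \<open>
  With $A(z) = \sum_{m \in S} z^m$ and $V(z) = \sum_l v_l z^l$, averaging $V \overline{A}^2$ over the
  $2N$-th roots of unity gives $\sum_{m,n \in S} v_{m+n} \ge d |S|^2$, while averaging $|A|^2$ gives $|S|$.
\<close>

lemma exists_large_exponential_sum:
  fixes v :: "nat \<Rightarrow> real"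
  assumes S: "S \<subseteq> {..<N}" "S \<noteq> {}" and v: "\<And>m n. m \<in> S \<Longrightarrow> n \<in> S \<Longrightarrow> d \<le> v (m + n)"
  shows "\<exists>z::complex. norm z = 1 \<and> d * card S \<le> norm (\<Sum>l<2*N. of_real (v l) * z ^ l)"
proof -
  define M where "M = 2 * N"
  have fin: "finite S" using S(1) finite_subset by auto
  have M: "0 < M" using S by (auto simp: M_def)
  define \<zeta> :: "nat \<Rightarrow> complex" where "\<zeta> k = cis (2 * pi * k / M)" for k
  define W where "W k = (\<Sum>l<M. of_real (v l) * \<zeta> k ^ l)" for k
  define A where "A k = (\<Sum>m\<in>S. \<zeta> k ^ m)" for k
  have orth: "(\<Sum>k<M. \<zeta> k ^ a * cnj (\<zeta> k) ^ b) = (if a = b then of_nat M else 0)"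
    if "a < M" "b < M" for a b
    using sum_roots_of_unity_orthogonal[OF that] by (simp add: \<zeta>_def)
  \<comment> \<open>\<open>M = 2 * N\<close> exceeds every sum \<open>m + n\<close>, so
    orthogonality singles out \<open>l = m + n\<close> with no wrap-around modulo
    \<open>M\<close>.\<close>
  have lt: "m < M" "m + n < M" if "m \<in> S" "n \<in> S" for m n
    using subsetD[OF S(1) that(1)] subsetD[OF S(1) that(2)] by (auto simp: M_def)
  have "(\<Sum>k<M. A k * cnj (A k)) = (\<Sum>k<M. \<Sum>m\<in>S. \<Sum>n\<in>S. \<zeta> k ^ m * cnj (\<zeta> k) ^ n)"
    by (simp add: A_def sum_product)
  also have "\<dots> = (\<Sum>m\<in>S. \<Sum>n\<in>S. \<Sum>k<M. \<zeta> k ^ m * cnj (\<zeta> k) ^ n)"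
    by (rule trans[OF sum.swap], rule sum.cong[OF refl], rule sum.swap)
  also have "\<dots> = (\<Sum>m\<in>S. \<Sum>n\<in>S. if m = n then of_nat M else 0)"
    by (rule sum.cong[OF refl], rule sum.cong[OF refl], rule orth) (auto intro: lt)
  also have "\<dots> = of_nat M * card S" using fin by simp
  finally have "(\<Sum>k<M. A k * cnj (A k)) = of_nat M * card S" .
  then have "of_real (\<Sum>k<M. (norm (A k))\<^sup>2) = (of_real (real M * card S) :: complex)"
    by (simp add: complex_norm_square del: of_real_power)
  then have parseval: "(\<Sum>k<M. (norm (A k))\<^sup>2) = real M * card S"
    using of_real_eq_iff by blast
  have "W k * (cnj (A k) * cnj (A k)) =
      (\<Sum>m\<in>S. \<Sum>n\<in>S. \<Sum>l<M. of_real (v l) * (\<zeta> k ^ l * cnj (\<zeta> k) ^ (m + n)))" for k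
  proof -
    have "cnj (A k) * cnj (A k) = (\<Sum>m\<in>S. \<Sum>n\<in>S. cnj (\<zeta> k) ^ (m + n))"
      by (simp add: A_def sum_product power_add)
    then have "W k * (cnj (A k) * cnj (A k)) = (\<Sum>m\<in>S. \<Sum>n\<in>S. W k * cnj (\<zeta> k) ^ (m + n))"
      by (simp only: sum_distrib_left)
    also have "\<dots> = (\<Sum>m\<in>S. \<Sum>n\<in>S. \<Sum>l<M. of_real (v l) * (\<zeta> k ^ l * cnj (\<zeta> k) ^ (m + n)))"
      by (simp only: W_def sum_distrib_right mult.assoc)
    finally show ?thesis .
  qed
  then have "(\<Sum>k<M. W k * (cnj (A k) * cnj (A k))) =
      (\<Sum>k<M. \<Sum>m\<in>S. \<Sum>n\<in>S. \<Sum>l<M. of_real (v l) * (\<zeta> k ^ l * cnj (\<zeta> k) ^ (m + n)))"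
    by (simp only:)
  also have "\<dots> = (\<Sum>m\<in>S. \<Sum>n\<in>S. \<Sum>l<M. \<Sum>k<M. of_real (v l) * (\<zeta> k ^ l * cnj (\<zeta> k) ^ (m + n)))"
    by (rule trans[OF sum.swap], rule sum.cong[OF refl], rule trans[OF sum.swap],
        rule sum.cong[OF refl], rule sum.swap)
  also have "\<dots> = (\<Sum>m\<in>S. \<Sum>n\<in>S. \<Sum>l<M. of_real (v l) * (if l = m + n then of_nat M else 0))"
    by (rule sum.cong[OF refl], rule sum.cong[OF refl], rule sum.cong[OF refl])
       (simp only: orth lt lessThan_iff flip: sum_distrib_left)
  also have "\<dots> = (\<Sum>m\<in>S. \<Sum>n\<in>S. of_real (v (m + n) * M))"
    by (rule sum.cong[OF refl], rule sum.cong[OF refl])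
       (simp add: lt if_distrib[where f="\<lambda>x. _ * x"] cong: if_cong)
  finally have eq: "(\<Sum>k<M. W k * (cnj (A k) * cnj (A k))) = of_real (\<Sum>m\<in>S. \<Sum>n\<in>S. v (m + n) * M)"
    by simp
  \<comment> \<open>Bounding every coefficient by the largest one reduces the estimate to Parseval;
    this \<open>k\<close> yields the required \<open>z\<close>.\<close>
  obtain k where k: "\<And>j. j < M \<Longrightarrow> norm (W j) \<le> norm (W k)"
  proof -
    let ?N = "(\<lambda>k. norm (W k)) ` {..<M}"
    have "Max ?N \<in> ?N" using M by (intro Max_in) auto
    then obtain k where "norm (W k) = Max ?N" by auto
    then show ?thesis by (intro that[of k]) simp
  qed
  have "(d * card S) * (real M * card S) = (\<Sum>m\<in>S. \<Sum>n\<in>S. d * M)" by simp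
  also have "\<dots> \<le> (\<Sum>m\<in>S. \<Sum>n\<in>S. v (m + n) * M)"
    by (intro sum_mono mult_right_mono v) auto
  also have "\<dots> \<le> norm (\<Sum>k<M. W k * (cnj (A k) * cnj (A k)))"
    unfolding eq norm_of_real by simp
  also have "\<dots> \<le> (\<Sum>j<M. norm (W k) * (norm (A j))\<^sup>2)"
    by (rule sum_norm_le) (auto simp: norm_mult power2_eq_square intro!: mult_right_mono k)
  also have "\<dots> = norm (W k) * (real M * card S)"
    by (simp add: parseval flip: sum_distrib_left)
  finally have "d * card S \<le> norm (W k)"
    using M S fin by (auto simp: card_gt_0_iff)
  then show ?thesis
    by (intro exI[of _ "\<zeta> k"]) (simp add: W_def M_def \<zeta>_def)
qed

section \<open>Logarithms on simply connected spaces\<close>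

lemma path_component_of_continuous_map:
  assumes "continuous_map X Y f" "path_component_of X a b"
  shows "path_component_of Y (f a) (f b)"
  using assms pathin_compose[OF _ assms(1)] unfolding path_component_of_def by (metis comp_apply)

text \<open>
  The pullback of the covering \<^term>\<open>exp\<close> along \<open>f\<close>: its paths are the paths of \<open>Y\<close> together
  with a continuous logarithm of \<open>f\<close>.
\<close>

definition logarithm_space :: "'a topology \<Rightarrow> ('a \<Rightarrow> complex) \<Rightarrow> ('a \<times> complex) topology" where
  "logarithm_space Y f = subtopology (prod_topology Y euclidean) {p. f (fst p) = exp (snd p)}"

lemma pathin_logarithm_space:
  "pathin (logarithm_space Y f) p \<longleftrightarrow>
    pathin Y (fst \<circ> p) \<and> continuous_on {0..1} (snd \<circ> p) \<and> (\<forall>t\<in>{0..1}. f (fst (p t)) = exp (snd (p t)))"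
  by (auto simp: logarithm_space_def pathin_def continuous_map_in_subtopology continuous_map_pairwise
      Pi_iff)

text \<open>A continuous map from a compact space to a Hausdorff space is closed. Through this
  quotient a closed path becomes a continuous map on the circle, the form to which
  \<open>simply_connected_space\<close> applies.\<close>

lemma quotient_map_circle:
  "quotient_map (top_of_set {0..1}) (top_of_set (sphere 0 1)) (\<lambda>t. exp (2 * pi * t * \<i>))"
  (is "quotient_map ?I ?C ?e")
proof (rule continuous_closed_imp_quotient_map)
  have "continuous_on {0..1} ?e" by (intro continuous_intros)
  then show cont: "continuous_map ?I ?C ?e"
    by (auto simp: continuous_map_in_subtopology norm_exp_i_times mult.commute)
  show "closed_map ?I ?C ?e"
    by (rule continuous_imp_closed_map_gen[OF _ _ cont])
       (auto simp: compact_space_subtopology Hausdorff_imp_kc_space Hausdorff_space_subtopology)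
  have "z \<in> ?e ` {0..1}" if "norm z = 1" for z
  proof (rule image_eqI)
    show "z = ?e (Arg2pi z / (2 * pi))"
      using Arg2pi_eq[of z] that by (simp add: mult.commute)
    show "Arg2pi z / (2 * pi) \<in> {0..1}"
      using Arg2pi_ge_0[of z] Arg2pi_lt_2pi[of z] by (simp add: field_simps)
  qed
  then show "?e ` topspace ?I = topspace ?C"
    by (auto simp: norm_exp_i_times mult.commute)
qed

text \<open>Trivial monodromy: a null-homotopy of the projected loop makes \<open>f\<close> along it
  inessential in the punctured plane, so it has a logarithm on the whole circle. The logarithm
  carried by the path differs from that one by a constant, hence has equal values at both
  ends.\<close>

lemma logarithm_space_lift_unique:
  assumes sc: "simply_connected_space Y"
    and f: "continuous_map Y euclidean f" "\<And>y. y \<in> topspace Y \<Longrightarrow> f y \<noteq> 0"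
    and path: "path_component_of (logarithm_space Y f) (y, w) (y, w')"
  shows "w = w'"
proof -
  let ?I = "top_of_set {0..1::real}" and ?C = "top_of_set (sphere (0::complex) 1)"
  define e where "e = (\<lambda>t::real. exp (2 * pi * t * \<i>))"
  obtain p where p: "pathin (logarithm_space Y f) p" "p 0 = (y, w)" "p 1 = (y, w')"
    using path unfolding path_component_of_def by blast
  define q where "q = fst \<circ> p"
  define l where "l = snd \<circ> p"
  have q: "continuous_map ?I Y q" "q 0 = q 1" and l: "continuous_on {0..1} l" "l 0 = w" "l 1 = w'"
    and fq: "\<And>t. t \<in> {0..1} \<Longrightarrow> f (q t) = exp (l t)"
    using p(1)[unfolded pathin_logarithm_space, unfolded pathin_def] p(2,3) by (auto simp: q_def l_def)
  \<comment> \<open>\<open>Arg2pi\<close> takes values in [0, 2 pi), so the point 1 of the circle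
    receives \<open>q 0\<close>; agreement with the path at \<open>t = 1\<close> rests on
    \<open>q 0 = q 1\<close>.\<close>
  define \<gamma> where "\<gamma> z = q (Arg2pi z / (2 * pi))" for z
  have e1: "e 1 = 1" by (simp add: e_def)
  have \<gamma>e: "\<gamma> (e t) = q t" if t: "t \<in> {0..1}" for t
  proof (cases "t = 1")
    case True
    then show ?thesis using q(2) by (simp add: \<gamma>_def e1 Arg2pi_unique[of 1 0 1])
  next
    case False
    have "Arg2pi (e t) = 2 * pi * t"
      using t False by (intro Arg2pi_unique[of 1]) (auto simp: e_def mult_ac)
    then show ?thesis by (simp add: \<gamma>_def)
  qed
  have "continuous_map ?C Y \<gamma>"
  proof (rule continuous_compose_quotient_map[OF quotient_map_circle[folded e_def]])
    show "continuous_map ?I Y (\<gamma> \<circ> e)"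
      by (rule continuous_map_eq[OF q(1)]) (simp add: \<gamma>e)
  qed
  from sc[unfolded simply_connected_space_def, rule_format, OF this]
  obtain F x0 where x0: "x0 \<in> topspace Y" and F: "continuous_map (prod_topology ?C ?I) Y F"
    and F01: "\<And>z. z \<in> sphere 0 1 \<Longrightarrow> F (z, 0) = \<gamma> z \<and> F (z, 1) = x0"
    by blast
  have "homotopic_with_canon (\<lambda>h. True) (sphere 0 1) (-{0}) (f \<circ> \<gamma>) (\<lambda>_. f x0)"
  proof -
    have "continuous_map (prod_topology ?I ?C) (prod_topology ?C ?I) (\<lambda>p. (snd p, fst p))"
      by (intro continuous_map_pairedI continuous_map_fst continuous_map_snd)
    from continuous_map_compose[OF continuous_map_compose[OF this F] f(1)]
    have "continuous_map (prod_topology ?I ?C) euclidean (\<lambda>p. f (F (snd p, fst p)))"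
      by (simp add: o_def)
    moreover have "f (F (snd p, fst p)) \<noteq> 0" if "p \<in> {0..1} \<times> sphere 0 1" for p
    proof -
      have "F (snd p, fst p) \<in> topspace Y"
        using F that by (auto simp: continuous_map_def Pi_iff)
      then show ?thesis by (rule f(2))
    qed
    ultimately have "continuous_map (prod_topology ?I ?C) (top_of_set (-{0})) (\<lambda>p. f (F (snd p, fst p)))"
      by (auto simp: continuous_map_in_subtopology)
    then show "homotopic_with_canon (\<lambda>h. True) (sphere 0 1) (-{0}) (f \<circ> \<gamma>) (\<lambda>_. f x0)"
      by (subst homotopic_with) (auto simp: F01 intro!: exI[of _ "\<lambda>p. f (F (snd p, fst p))"])
  qed
  then obtain g where g: "continuous_on (sphere 0 1) g" "\<And>z. z \<in> sphere 0 1 \<Longrightarrow> f (\<gamma> z) = exp (g z)"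
    using inessential_eq_continuous_logarithm[of "sphere 0 1" "f \<circ> \<gamma>"] by auto
  have e_sphere: "e t \<in> sphere 0 1" for t by (simp add: e_def norm_exp_i_times mult.commute)
  \<comment> \<open>Two logarithms of the same function are compared, so the values of
    \<open>d\<close> lie in the discrete set 2 pi i Z and continuity on an interval makes
    \<open>d\<close> constant.\<close>
  define d where "d t = l t - g (e t)" for t
  have "d constant_on {0..1}"
  proof (rule continuous_discrete_range_constant)
    show "continuous_on {0..1} d"
      unfolding d_def
      by (intro continuous_intros l(1) continuous_on_compose2[OF g(1), of _ e])
         (use e_sphere in \<open>auto simp: e_def intro!: continuous_intros\<close>)
    have exp_d: "exp (d t) = 1" if "t \<in> {0..1}" for t
      using fq[OF that] \<gamma>e[OF that] g(2)[OF e_sphere, of t] by (simp add: d_def exp_diff)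
    show "\<exists>r>0. \<forall>s. s \<in> {0..1} \<and> d s \<noteq> d t \<longrightarrow> r \<le> norm (d s - d t)" if t: "t \<in> {0..1}" for t
    proof (intro exI[of _ "2 * pi"] conjI allI impI)
      fix s assume s: "s \<in> {0..1} \<and> d s \<noteq> d t"
      then have "exp (d s) = exp (d t)" using exp_d[of s] exp_d[OF t] by simp
      then have "\<not> \<bar>Im (d s) - Im (d t)\<bar> < 2 * pi"
        using exp_complex_eqI[of "d s" "d t"] s by blast
      then show "2 * pi \<le> norm (d s - d t)"
        using abs_Im_le_cmod[of "d s - d t"] by simp
    qed simp
  qed simp
  then have "d 0 = d 1" by (auto simp: constant_on_def)
  then show ?thesis using l e1 by (simp add: d_def e_def)
qed

text \<open>A logarithm exists over the contractible interval; adding the constant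
  \<open>w - g 0\<close>, whose exponential is 1, makes it start at \<open>w\<close>.\<close>

lemma logarithm_space_lift_path:
  assumes f: "continuous_map Y euclidean f" "\<And>y. y \<in> topspace Y \<Longrightarrow> f y \<noteq> 0"
    and p: "pathin Y p" and w: "f (p 0) = exp w"
  obtains w' where "path_component_of (logarithm_space Y f) (p 0, w) (p 1, w')"
proof -
  have cont: "continuous_on {0..1} (f \<circ> p)"
    using continuous_map_compose[OF p[unfolded pathin_def] f(1)] by simp
  have nz: "(f \<circ> p) t \<noteq> 0" if "t \<in> {0..1}" for t
    using f(2) funcset_mem[OF path_image_subset_topspace[OF p] that] by simp
  have "contractible {0..1::real}" by (simp add: convex_imp_contractible)
  then obtain g where g: "continuous_on {0..1} g" "\<And>t. t \<in> {0..1} \<Longrightarrow> (f \<circ> p) t = exp (g t)"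
    using continuous_logarithm_on_contractible[OF cont _ nz] by blast
  have "exp (w - g 0) = 1" using g(2)[of 0] w by (simp add: exp_diff)
  then have "pathin (logarithm_space Y f) (\<lambda>t. (p t, g t + (w - g 0)))"
    using p g unfolding pathin_logarithm_space by (auto simp: o_def exp_add intro!: continuous_intros)
  then show ?thesis
    by (intro that[of "g 1 + (w - g 0)"]) (auto simp: path_component_of_def)
qed

text \<open>Local path connectedness confines a path from \<open>x\<close> to a nearby
  \<open>y\<close> to a set where the quotient of \<open>f\<close> by \<open>f x\<close> stays close
  to 1. There the principal branch \<open>Ln\<close> supplies a small continuous change of
  logarithm.\<close>

lemma logarithm_space_lift_local:
  assumes lpc: "locally_path_connected_space Y"
    and f: "continuous_map Y euclidean f" "f x \<noteq> 0"
    and x: "x \<in> topspace Y" and w: "f x = exp w" and e: "0 < e"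
  obtains U where "openin Y U" "x \<in> U"
    "\<And>y. y \<in> U \<Longrightarrow> \<exists>d. norm d < e \<and> path_component_of (logarithm_space Y f) (x, w) (y, w + d)"
proof -
  have "isCont Ln 1" by (intro continuous_intros) auto
  then obtain r where r: "0 < r" "\<And>z. dist z 1 < r \<Longrightarrow> dist (Ln z) (Ln 1) < e"
    using e unfolding continuous_at_eps_delta by metis
  \<comment> \<open>The radius \<open>r\<close> makes \<open>Ln\<close> of the quotient small; the
    radius 1 keeps the quotient in the right half-plane, off the branch cut.\<close>
  define B where "B = {y \<in> topspace Y. f y / f x \<in> ball 1 (min r 1)}"
  have "continuous_map Y euclidean (\<lambda>y. f y / f x)"
    using continuous_map_compose[OF f(1), of euclidean "\<lambda>z. z / f x"] f(2)
    by (simp add: o_def continuous_intros)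
  then have "openin Y B"
    unfolding B_def by (rule openin_continuous_map_preimage) simp
  moreover have "x \<in> B" using x f(2) r(1) by (simp add: B_def)
  ultimately obtain U P where UP: "openin Y U" "path_connectedin Y P" "x \<in> U" "U \<subseteq> P" "P \<subseteq> B"
    using lpc unfolding locally_path_connected_space_def neighbourhood_base_of by metis
  show ?thesis
  proof (rule that[OF UP(1,3)])
    fix y assume "y \<in> U"
    then obtain q where q: "pathin Y q" "q \<in> {0..1} \<rightarrow> P" "q 0 = x" "q 1 = y"
      using UP unfolding path_connectedin by (metis subsetD)
    define l where "l t = Ln (f (q t) / f x)" for t
    have qB: "q t \<in> B" if "t \<in> {0..1}" for t using q(2) UP(5) that by blast
    have near: "norm (f (q t) / f x - 1) < 1" if "t \<in> {0..1}" for t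
      using qB[OF that] by (simp add: B_def dist_norm norm_minus_commute)
    have slit: "f (q t) / f x \<notin> \<real>\<^sub>\<le>\<^sub>0" if "t \<in> {0..1}" for t
    proof
      assume "f (q t) / f x \<in> \<real>\<^sub>\<le>\<^sub>0"
      then have "Re (f (q t) / f x) \<le> 0" by (simp add: complex_nonpos_Reals_iff)
      then show False
        using near[OF that] abs_Re_le_cmod[of "f (q t) / f x - 1"] by simp
    qed
    have "continuous_on {0..1} (\<lambda>t. f (q t))"
      using continuous_map_compose[OF q(1)[unfolded pathin_def] f(1)] by (simp add: o_def)
    then have "continuous_on {0..1} l"
      unfolding l_def using f(2) slit by (intro continuous_intros) auto
    moreover have "f (q t) = exp (w + l t)" if "t \<in> {0..1}" for t
    proof -
      have "f (q t) / f x \<noteq> 0" using slit[OF that] by force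
      then show ?thesis using f(2) by (simp add: exp_add l_def flip: w)
    qed
    ultimately have "pathin (logarithm_space Y f) (\<lambda>t. (q t, w + l t))"
      using q(1) unfolding pathin_logarithm_space by (auto simp: o_def intro!: continuous_intros)
    moreover have "l 0 = 0" using f(2) q(3) by (simp add: l_def)
    ultimately have "path_component_of (logarithm_space Y f) (x, w) (y, w + l 1)"
      using q(3,4) unfolding path_component_of_def by force
    moreover have "norm (l 1) < e"
      using r(2)[of "f (q 1) / f x"] qB[of 1] by (simp add: l_def B_def dist_norm norm_minus_commute)
    ultimately show "\<exists>d. norm d < e \<and> path_component_of (logarithm_space Y f) (x, w) (y, w + d)"
      by blast
  qed
qed

text \<open>
  Lifting a path from \<open>x\<close> to \<open>T x\<close> changes the logarithm of \<open>f\<close> by some \<open>c \<noteq> 0\<close>, so \<open>n\<close> translates of it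
  change it by \<open>n * c\<close>, whereas a point near \<open>x\<close> can be reached with a change smaller than \<open>c\<close>.
\<close>

lemma no_eigenfunction_on_simply_connected:
  fixes Y :: "'a topology" and f :: "'a \<Rightarrow> complex"
  assumes pc: "path_connected_space Y" and lpc: "locally_path_connected_space Y"
    and sc: "simply_connected_space Y"
    and T: "continuous_map Y Y T" and f: "continuous_map Y euclidean f"
    and nz: "\<And>y. y \<in> topspace Y \<Longrightarrow> f y \<noteq> 0"
    and eigen: "\<And>y. y \<in> topspace Y \<Longrightarrow> f (T y) = \<mu> * f y"
    and x: "x \<in> topspace Y"
    and recurrent: "\<And>U. openin Y U \<Longrightarrow> x \<in> U \<Longrightarrow> \<exists>n>0. (T ^^ n) x \<in> U"
  shows "\<mu> = 1"
proof (rule ccontr)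
  assume \<mu>: "\<mu> \<noteq> 1"
  let ?Z = "logarithm_space Y f"
  define w where "w = Ln (f x)"
  have w: "f x = exp w" using nz[OF x] by (simp add: w_def)
  have Tx: "T x \<in> topspace Y" using T x by (auto simp: continuous_map_def)
  then obtain p where p: "pathin Y p" "p 0 = x" "p 1 = T x"
    using pc x unfolding path_connected_space_def by blast
  obtain w' where w': "path_component_of ?Z (x, w) (T x, w')"
    using logarithm_space_lift_path[OF f nz p(1), of w] p w by metis
  then have "(T x, w') \<in> topspace ?Z" by (rule path_component_in_topspace[THEN conjunct2])
  then have fTx: "f (T x) = exp w'" by (simp add: logarithm_space_def)
  define c where "c = w' - w"
  have ec: "exp c = \<mu>" 
    unfolding c_def exp_diff fTx[symmetric] eigen[OF x] w[symmetric] using nz[OF x] by simp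
  then have c: "c \<noteq> 0" using \<mu> by auto
  \<comment> \<open>A lift of \<open>T\<close> that preserves the logarithm space because
    \<open>exp c = \<mu>\<close>. Moving a path from \<open>(x, w)\<close> by it and prefixing the
    path to \<open>(T x, w')\<close> gives the induction on \<open>n\<close> below.\<close>
  define \<sigma> where "\<sigma> q = (T (fst q), snd q + c)" for q :: "'a \<times> complex"
  have \<sigma>: "continuous_map ?Z ?Z \<sigma>"
    unfolding logarithm_space_def continuous_map_in_subtopology
  proof
    have "continuous_map (prod_topology Y euclidean) (prod_topology Y euclidean) \<sigma>"
      unfolding \<sigma>_def
      using continuous_map_compose[OF continuous_map_fst T, of euclidean]
        continuous_map_compose[OF continuous_map_snd[of Y "euclidean :: complex topology"],
          of euclidean "\<lambda>z. z + c"]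
      by (intro continuous_map_pairedI) (auto simp: o_def continuous_intros)
    then show "continuous_map (subtopology (prod_topology Y euclidean) {p. f (fst p) = exp (snd p)})
        (prod_topology Y euclidean) \<sigma>"
      by (rule continuous_map_from_subtopology)
  qed (auto simp: \<sigma>_def eigen exp_add ec)
  have iter: "path_component_of ?Z (x, w) ((T ^^ n) x, w + of_nat n * c)" for n
  proof (induction n)
    case 0
    show ?case using x w by (simp add: logarithm_space_def path_component_of_refl)
  next
    case (Suc n)
    have "path_component_of ?Z (\<sigma> (x, w)) (\<sigma> ((T ^^ n) x, w + of_nat n * c))"
      using path_component_of_continuous_map[OF \<sigma> Suc] .
    moreover have "\<sigma> (x, w) = (T x, w')" by (simp add: \<sigma>_def c_def)
    moreover have "\<sigma> ((T ^^ n) x, w + of_nat n * c) = ((T ^^ Suc n) x, w + of_nat (Suc n) * c)"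
      by (simp add: \<sigma>_def algebra_simps)
    ultimately show ?case using path_component_of_trans[OF w'] by metis
  qed
  have "0 < norm c" using c by simp
  then obtain U where U: "openin Y U" "x \<in> U"
    "\<And>y. y \<in> U \<Longrightarrow> \<exists>d. norm d < norm c \<and> path_component_of ?Z (x, w) (y, w + d)"
    using logarithm_space_lift_local[OF lpc f nz[OF x] x w] by metis
  obtain n where n: "0 < n" "(T ^^ n) x \<in> U" using recurrent[OF U(1,2)] by blast
  obtain d where d: "norm d < norm c" "path_component_of ?Z (x, w) ((T ^^ n) x, w + d)"
    using U(3)[OF n(2)] by blast
  have "path_component_of ?Z ((T ^^ n) x, w + of_nat n * c) ((T ^^ n) x, w + d)"
    using path_component_of_trans[OF iter[of n, THEN path_component_of_sym] d(2)] .
  from logarithm_space_lift_unique[OF sc f nz this] have "of_nat n * c = d" by simp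
  then have "norm d = real n * norm c" by (simp add: norm_mult flip: \<open>of_nat n * c = d\<close>)
  moreover have "1 * norm c \<le> real n * norm c" using n(1) by (intro mult_right_mono) auto
  ultimately show False using d(1) by simp
qed

section \<open>Eigenfunctions on compact monothetic groups\<close>

lemma continuous_map_euclidean_distI:
  fixes f :: "'a \<Rightarrow> 'b::metric_space"
  assumes "\<And>x e. x \<in> topspace X \<Longrightarrow> 0 < e \<Longrightarrow>
    \<exists>U. openin X U \<and> x \<in> U \<and> (\<forall>y\<in>U. dist (f y) (f x) < e)"
  shows "continuous_map X euclidean f"
  unfolding continuous_map_def
proof (intro conjI allI impI)
  fix V :: "'b set" assume "openin euclidean V"
  then have V: "open V" by simp
  show "openin X {x \<in> topspace X. f x \<in> V}"
  proof (subst openin_subopen, clarify)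
    fix x assume x: "x \<in> topspace X" "f x \<in> V"
    then obtain e where e: "0 < e" "ball (f x) e \<subseteq> V"
      using V open_contains_ball by blast
    obtain U where U: "openin X U" "x \<in> U" "\<forall>y\<in>U. dist (f y) (f x) < e"
      using assms[OF x(1) e(1)] by blast
    have "U \<subseteq> {x \<in> topspace X. f x \<in> V}"
      using U e(2) openin_subset[OF U(1)] by (auto simp: dist_commute subset_iff)
    then show "\<exists>U. openin X U \<and> x \<in> U \<and> U \<subseteq> {x \<in> topspace X. f x \<in> V}"
      using U by blast
  qed
qed auto

text \<open>A tube argument: the pairs at distance at least \<open>e\<close> form a closed set, and
  projection along the compact \<open>K\<close> is closed, so the complement of the projection is
  the neighbourhood.\<close>

lemma compact_space_equicontinuous:
  fixes k :: "'a \<Rightarrow> 'b \<Rightarrow> 'c::metric_space"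
  assumes K: "compact_space K"
    and k: "continuous_map (prod_topology X K) euclidean (\<lambda>p. k (fst p) (snd p))"
    and x: "x \<in> topspace X" and e: "0 < e"
  obtains U where "openin X U" "x \<in> U" "\<And>y s. y \<in> U \<Longrightarrow> s \<in> topspace K \<Longrightarrow> dist (k y s) (k x s) < e"
proof -
  define D where
    "D = {p \<in> topspace (prod_topology X K). dist (k (fst p) (snd p)) (k x (snd p)) \<in> {e..}}"
  have "continuous_map (prod_topology X K) (prod_topology X K) (\<lambda>p. (x, snd p))"
    using x by (auto intro!: continuous_intros simp: continuous_map_pairedI continuous_map_snd)
  from continuous_map_compose[OF this k]
  have "continuous_map (prod_topology X K) euclidean (\<lambda>p. k x (snd p))"
    by (simp add: o_def)
  then have pair: "continuous_map (prod_topology X K) euclidean (\<lambda>p. (k (fst p) (snd p), k x (snd p)))"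
    using continuous_map_pairedI[OF k] by (metis prod_topology_euclidean)
  have "continuous_map euclidean euclideanreal (\<lambda>p :: 'c \<times> 'c. dist (fst p) (snd p))"
    by (simp add: continuous_on_dist continuous_on_fst continuous_on_snd)
  from continuous_map_compose[OF pair this]
  have "continuous_map (prod_topology X K) euclideanreal (\<lambda>p. dist (k (fst p) (snd p)) (k x (snd p)))"
    by (simp add: o_def)
  then have "closedin (prod_topology X K) D"
    unfolding D_def by (rule closedin_continuous_map_preimage) simp
  then have "closedin X (fst ` D)"
    using closed_map_fst[OF K, of X] by (simp add: closed_map_def)
  then show ?thesis
    using x e by (intro that[of "topspace X - fst ` D"]) (force simp: D_def)+
qed

section \<open>Uniformity, return times and coset-invariant functions in a compact group\<close>

context topological_group
begin

lemma continuous_map_mult [continuous_intros]: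
  assumes "continuous_map X \<T> f" "continuous_map X \<T> h"
  shows "continuous_map X \<T> (\<lambda>x. f x \<otimes> h x)"
  using continuous_map_compose[OF continuous_map_pairedI[OF assms] continuous_mult]
  by (simp add: o_def)

lemma continuous_map_lmult: "a \<in> carrier G \<Longrightarrow> continuous_map \<T> \<T> (\<lambda>x. a \<otimes> x)"
  and continuous_map_rmult: "a \<in> carrier G \<Longrightarrow> continuous_map \<T> \<T> (\<lambda>x. x \<otimes> a)"
  using topspace_eq_carrier by (auto intro!: continuous_intros)

text \<open>The left factor \<open>z\<close> ranges over a compact group, which makes the estimate
  uniform in it. This uniformity lets averages over the translates by \<open>g [^] l\<close> inherit
  the continuity of \<open>u\<close>.\<close>

lemma right_uniformly_continuous:
  fixes u :: "'a \<Rightarrow> 'c::metric_space"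
  assumes "compact_space \<T>" and u: "continuous_map \<T> euclidean u" and x: "x \<in> carrier G" and "0 < e"
  obtains W where "openin \<T> W" "x \<in> W"
    "\<And>w z. w \<in> W \<Longrightarrow> z \<in> carrier G \<Longrightarrow> dist (u (z \<otimes> w)) (u (z \<otimes> x)) < e"
proof -
  have "continuous_map (prod_topology \<T> \<T>) \<T> (\<lambda>p. snd p \<otimes> fst p)"
    by (intro continuous_intros continuous_map_fst continuous_map_snd)
  from continuous_map_compose[OF this u]
  have "continuous_map (prod_topology \<T> \<T>) euclidean (\<lambda>p. u (snd p \<otimes> fst p))"
    by (simp add: o_def)
  then obtain W where W: "openin \<T> W" "x \<in> W"
    "\<And>w z. w \<in> W \<Longrightarrow> z \<in> topspace \<T> \<Longrightarrow> dist (u (z \<otimes> w)) (u (z \<otimes> x)) < e"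
    by (rule compact_space_equicontinuous[where k = "\<lambda>w z. u (z \<otimes> w)" and x = x,
          OF assms(1) _ _ \<open>0 < e\<close>]) (use x topspace_eq_carrier in blast)+
  show ?thesis
    by (rule that[OF W(1,2)]) (simp add: W(3) topspace_eq_carrier)
qed

text \<open>The open sets of those \<open>x\<close> with \<open>g [^] j \<otimes> x \<in> W\<close>
  cover the group, because some \<open>g [^] j\<close> approximates \<open>inv x\<close>. A finite
  subcover, applied at \<open>x = g [^] n\<close>, bounds the waiting time.\<close>

lemma generator_returns_syndetic:
  assumes "compact_space \<T>" and g: "topological_generator G \<T> g" and W: "openin \<T> W" "\<one> \<in> W"
  obtains J :: nat where "0 < J" "\<And>n. \<exists>j<J. g [^] (n + j) \<in> W"
proof -
  have gc: "g \<in> carrier G" and dense: "\<T> closure_of {g [^] n |n::nat. True} = carrier G"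
    using g topspace_eq_carrier by (auto simp: topological_generator_def dense_in_def)
  define U where "U j = {x \<in> topspace \<T>. g [^] j \<otimes> x \<in> W}" for j :: nat
  have "openin \<T> (U j)" for j
    unfolding U_def using gc W(1) by (intro openin_continuous_map_preimage[OF continuous_map_lmult]) auto
  moreover have "\<exists>j. x \<in> U j" if x: "x \<in> carrier G" for x
  proof -
    define V where "V = {y \<in> topspace \<T>. y \<otimes> x \<in> W}"
    have "openin \<T> V"
      unfolding V_def using x W(1) by (intro openin_continuous_map_preimage[OF continuous_map_rmult]) auto
    moreover have "inv x \<in> V"
      using x W(2) topspace_eq_carrier by (simp add: V_def)
    moreover have "inv x \<in> \<T> closure_of {g [^] n |n::nat. True}"
      unfolding dense using x by (rule inv_closed)
    ultimately obtain y where "y \<in> {g [^] n |n::nat. True}" "y \<in> V"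
      unfolding in_closure_of by blast
    then obtain n :: nat where "g [^] n \<otimes> x \<in> W"
      by (auto simp: V_def)
    then have "x \<in> U n" using x topspace_eq_carrier by (simp add: U_def)
    then show ?thesis ..
  qed
  ultimately have "Ball (range U) (openin \<T>)" "topspace \<T> \<subseteq> \<Union> (range U)"
    using topspace_eq_carrier by auto
  then have "\<exists>F. finite F \<and> F \<subseteq> range U \<and> topspace \<T> \<subseteq> \<Union>F"
    using assms(1) unfolding compact_space_alt by blast
  then obtain F where F: "finite F" "F \<subseteq> range U" "topspace \<T> \<subseteq> \<Union>F" by blast
  obtain I where I: "finite I" "F = U ` I"
    using finite_subset_image[OF F(1,2)] by blast
  show ?thesis
  \<comment> \<open>Inserting 0 avoids a separate case for empty \<open>I\<close>;
    \<open>Suc\<close> makes the bound strict.\<close>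
  proof (rule that[of "Suc (Max (insert 0 I))"])
    fix n :: nat
    have "g [^] n \<in> topspace \<T>" using gc topspace_eq_carrier by simp
    then obtain j where "j \<in> I" "g [^] n \<in> U j" using F(3) I(2) by blast
    moreover have "j \<le> Max (insert 0 I)" using I(1) \<open>j \<in> I\<close> by simp
    moreover have "g [^] (n + j) = g [^] j \<otimes> g [^] n"
      using gc by (simp add: nat_pow_mult add.commute)
    ultimately show "\<exists>j<Suc (Max (insert 0 I)). g [^] (n + j) \<in> W"
      by (intro exI[of _ j]) (simp add: U_def)
  qed simp
qed

text \<open>By compactness two powers of \<open>s\<close> with exponents \<open>m < n\<close> share
  a small open set. Then \<open>s [^] (n - m - 1)\<close>, an element of \<open>H\<close>, is close
  to \<open>inv s\<close>, so the closed set \<open>H\<close> cannot miss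
  \<open>inv s\<close>.\<close>

lemma closed_submonoid_inv_closed:
  assumes "compact_space \<T>" and H: "closedin \<T> H" "\<one> \<in> H" "\<And>x y. x \<in> H \<Longrightarrow> y \<in> H \<Longrightarrow> x \<otimes> y \<in> H"
    and s: "s \<in> H"
  shows "inv s \<in> H"
proof (rule ccontr)
  assume notin: "inv s \<notin> H"
  have Hc: "H \<subseteq> carrier G" using closedin_subset[OF H(1)] topspace_eq_carrier by simp
  then have sc: "s \<in> carrier G" using s by auto
  have pow: "s [^] n \<in> H" for n :: nat
    by (induction n) (auto simp: H s)
  \<comment> \<open>An open set of pairs that contains the diagonal because \<open>inv s\<close> is
    assumed to lie outside \<open>H\<close>; hence the group is covered by open sets whose squares
    lie in \<open>D\<close>.\<close>
  define D where "D = {p \<in> topspace (prod_topology \<T> \<T>). inv s \<otimes> (inv (fst p) \<otimes> snd p) \<in> topspace \<T> - H}"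
  have "continuous_map (prod_topology \<T> \<T>) \<T> (\<lambda>p. inv s \<otimes> (inv (fst p) \<otimes> snd p))"
    using sc topspace_eq_carrier continuous_map_compose[OF continuous_map_fst continuous_inv, of \<T>]
    by (intro continuous_intros continuous_map_snd) (auto simp: o_def)
  then have D: "openin (prod_topology \<T> \<T>) D"
    unfolding D_def using H(1) by (intro openin_continuous_map_preimage) auto
  have "\<exists>U. openin \<T> U \<and> x \<in> U \<and> U \<times> U \<subseteq> D" if x: "x \<in> topspace \<T>" for x
  proof -
    have "(x, x) \<in> D" using x sc notin topspace_eq_carrier by (simp add: D_def)
    then obtain U V where "openin \<T> U" "openin \<T> V" "x \<in> U" "x \<in> V" "U \<times> V \<subseteq> D"
      using D unfolding openin_prod_topology_alt by metis
    then show ?thesis by (intro exI[of _ "U \<inter> V"]) auto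
  qed
  then obtain U where U: "\<And>x. x \<in> topspace \<T> \<Longrightarrow> openin \<T> (U x) \<and> x \<in> U x \<and> U x \<times> U x \<subseteq> D"
    by metis
  have "\<exists>F. finite F \<and> F \<subseteq> U ` topspace \<T> \<and> topspace \<T> \<subseteq> \<Union>F"
  proof -
    have "Ball (U ` topspace \<T>) (openin \<T>)" "topspace \<T> \<subseteq> \<Union> (U ` topspace \<T>)" using U by auto
    then show ?thesis using assms(1) unfolding compact_space_alt by blast
  qed
  then obtain F where F: "finite F" "F \<subseteq> U ` topspace \<T>" "topspace \<T> \<subseteq> \<Union>F" by blast
  have "\<exists>V\<in>F. s [^] n \<in> V" for n :: nat using F(3) sc topspace_eq_carrier by auto
  then obtain V where V: "\<And>n::nat. V n \<in> F \<and> s [^] n \<in> V n" by metis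
  then have "\<not> inj V"
    using F(1) by (metis finite_imageD finite_subset image_subsetI infinite_UNIV_nat)
  then obtain m n where mn: "m < n" "V m = V n"
    by (metis injI nat_neq_iff)
  obtain x where "x \<in> topspace \<T>" "V m = U x" using V[of m] F(2) by blast
  then have "(s [^] m, s [^] n) \<in> D" using U[of x] V[of m] V[of n] mn by auto
  moreover have "n = m + Suc (n - m - 1)" using mn by simp
  then have "s [^] n = s [^] m \<otimes> (s \<otimes> s [^] (n - m - 1))"
    using sc by (metis nat_pow_mult nat_pow_Suc2)
  then have "inv s \<otimes> (inv (s [^] m) \<otimes> s [^] n) = s [^] (n - m - 1)"
    using sc by (simp add: inv_solve_left')
  ultimately show False using pow by (simp add: D_def)
qed

text \<open>Urysohn separates \<open>H\<close> from the coset of \<open>g\<close>; the supremum over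
  each left coset then gives invariance and keeps the values 0 and 1. It is continuous because
  compactness makes the estimate uniform over \<open>H\<close>.\<close>

lemma exists_right_invariant_separating:
  assumes "compact_space \<T>" "Hausdorff_space \<T>" and H: "closedin \<T> H" "subgroup H G"
    and g: "g \<in> carrier G" "g \<notin> H"
  obtains u :: "'a \<Rightarrow> real" where "continuous_map \<T> euclideanreal u" "\<And>x. x \<in> carrier G \<Longrightarrow> u x \<in> {0..1}"
    "u \<one> = 0" "u g = 1" "\<And>x s. x \<in> carrier G \<Longrightarrow> s \<in> H \<Longrightarrow> u (x \<otimes> s) = u x"
proof -
  interpret H: subgroup H G by fact
  define gH where "gH = {x \<in> topspace \<T>. inv g \<otimes> x \<in> H}"
  have "closedin \<T> gH"
    unfolding gH_def using g H(1) by (intro closedin_continuous_map_preimage[OF continuous_map_lmult]) auto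
  moreover have "x \<notin> H" if "x \<in> gH" for x
  proof
    assume x: "x \<in> H"
    then have "inv (inv g \<otimes> x) \<in> H" using that by (auto simp: gH_def)
    then have "x \<otimes> inv (inv g \<otimes> x) \<in> H" using x by auto
    then show False using g x H.subset by (simp add: inv_mult_group m_assoc[symmetric] subset_iff)
  qed
  ultimately obtain w :: "'a \<Rightarrow> real" where w: "continuous_map \<T> (top_of_set {0..1}) w"
    "w ` H \<subseteq> {0}" "w ` gH \<subseteq> {1}"
    using Urysohn_lemma[of \<T> H gH 0 1] H(1) assms(1,2) compact_Hausdorff_or_regular_imp_normal_space
    by (metis disjnt_iff zero_le_one)
  have w01: "w x \<in> {0..1}" if "x \<in> carrier G" for x
    using w(1) that topspace_eq_carrier by (auto simp: continuous_map_def)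
  have wc: "continuous_map \<T> euclideanreal w"
    using w(1) by (simp add: continuous_map_in_subtopology)
  define u where "u x = (SUP s\<in>H. w (x \<otimes> s))" for x
  have Hne: "H \<noteq> {}" using H.one_closed by blast
  have bdd: "bdd_above ((\<lambda>s. w (x \<otimes> s)) ` H)" if "x \<in> carrier G" for x
  proof (intro bdd_aboveI[of _ 1], elim imageE, hypsubst)
    show "w (x \<otimes> s) \<le> 1" if "s \<in> H" for s
      using w01[of "x \<otimes> s"] \<open>x \<in> carrier G\<close> H.mem_carrier[OF that] by simp
  qed
  have upper: "w (x \<otimes> s) \<le> u x" if "x \<in> carrier G" "s \<in> H" for x s
    unfolding u_def using bdd that by (auto intro: cSUP_upper)
  show ?thesis
  proof (rule that)
    show "u x \<in> {0..1}" if x: "x \<in> carrier G" for x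
    proof -
      have "0 \<le> w (x \<otimes> \<one>)" using w01 x by simp
      also have "\<dots> \<le> u x" using x by (intro upper) auto
      finally have "0 \<le> u x" .
      moreover have "u x \<le> 1"
        unfolding u_def
      proof (rule cSUP_least[OF Hne])
        show "w (x \<otimes> s) \<le> 1" if "s \<in> H" for s
          using w01[of "x \<otimes> s"] x H.mem_carrier[OF that] by simp
      qed
      ultimately show ?thesis by simp
    qed
    have "w (\<one> \<otimes> s) = 0" if "s \<in> H" for s
      using that w(2) by (simp add: image_subset_iff)
    then show "u \<one> = 0" using Hne by (simp add: u_def cSUP_const cong: SUP_cong_simp)
    have "g \<otimes> s \<in> gH" if "s \<in> H" for s
      using that g topspace_eq_carrier by (simp add: gH_def m_assoc[symmetric])
    then have "w (g \<otimes> s) = 1" if "s \<in> H" for s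
      using that w(3) by (simp add: image_subset_iff)
    then show "u g = 1" using Hne by (simp add: u_def cSUP_const cong: SUP_cong_simp)
    show "u (x \<otimes> s) = u x" if x: "x \<in> carrier G" and s: "s \<in> H" for x s
    proof -
      have "(\<lambda>t. s \<otimes> t) ` H = H"
      proof (intro equalityI subsetI)
        fix t assume t: "t \<in> H"
        then have "t = s \<otimes> (inv s \<otimes> t)" "inv s \<otimes> t \<in> H"
          using s by (auto simp: m_assoc[symmetric])
        then show "t \<in> (\<lambda>t. s \<otimes> t) ` H" by blast
      qed (use s in auto)
      then have "(\<lambda>t. w (x \<otimes> t)) ` H = (\<lambda>t. w (x \<otimes> t)) ` (\<lambda>t. s \<otimes> t) ` H" by simp
      also have "\<dots> = (\<lambda>t. w (x \<otimes> s \<otimes> t)) ` H"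
        using x s by (auto simp: image_image m_assoc intro!: image_cong)
      finally show ?thesis by (simp add: u_def)
    qed
    show "continuous_map \<T> euclideanreal u"
    proof (rule continuous_map_euclidean_distI)
      fix x and e :: real assume x: "x \<in> topspace \<T>" and e: "0 < e"
      have "continuous_map (prod_topology \<T> \<T>) \<T> (\<lambda>p. fst p \<otimes> snd p)"
        by (intro continuous_intros continuous_map_fst continuous_map_snd)
      from continuous_map_compose[OF this wc]
      have "continuous_map (prod_topology \<T> \<T>) euclideanreal (\<lambda>p. w (fst p \<otimes> snd p))"
        by (simp add: o_def)
      then obtain U where U: "openin \<T> U" "x \<in> U"
        "\<And>y s. y \<in> U \<Longrightarrow> s \<in> topspace \<T> \<Longrightarrow> dist (w (y \<otimes> s)) (w (x \<otimes> s)) < e / 2"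
        by (rule compact_space_equicontinuous[where k = "\<lambda>x s. w (x \<otimes> s)", OF assms(1) _ x half_gt_zero[OF e]])
           blast
      have "dist (u y) (u x) < e" if y: "y \<in> U" for y
      proof -
        have yc: "y \<in> carrier G" and xc: "x \<in> carrier G"
          using y x openin_subset[OF U(1)] topspace_eq_carrier by auto
        have le: "w (y \<otimes> s) \<le> w (x \<otimes> s) + e/2" "w (x \<otimes> s) \<le> w (y \<otimes> s) + e/2" if "s \<in> H" for s
          using U(3)[OF y, of s] that H.mem_carrier topspace_eq_carrier
          unfolding dist_real_def by (smt (verit) field_sum_of_halves)+
        have "u y \<le> u x + e/2"
          unfolding u_def[of y]
        proof (rule cSUP_least[OF Hne])
          show "w (y \<otimes> s) \<le> u x + e/2" if "s \<in> H" for s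
            using le(1)[OF that] upper[OF xc that] by linarith
        qed
        moreover have "u x \<le> u y + e/2"
          unfolding u_def[of x]
        proof (rule cSUP_least[OF Hne])
          show "w (x \<otimes> s) \<le> u y + e/2" if "s \<in> H" for s
            using le(2)[OF that] upper[OF yc that] by linarith
        qed
        ultimately show ?thesis using e by (auto simp: dist_real_def)
      qed
      then show "\<exists>U. openin \<T> U \<and> x \<in> U \<and> (\<forall>y\<in>U. dist (u y) (u x) < e)"
        using U by blast
    qed
  qed
qed

end

section \<open>Fourier averages as approximate eigenfunctions, and their limits\<close>

lemma sum_power_shift:
  fixes b :: "nat \<Rightarrow> complex"
  assumes "z \<noteq> 0"
  shows "(\<Sum>l<K. b (Suc l) * z ^ l) = inverse z * ((\<Sum>l<K. b l * z ^ l) + b K * z ^ K - b 0)"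
proof -
  have "z * (\<Sum>l<K. b (Suc l) * z ^ l) = (\<Sum>l<K. b (Suc l) * z ^ Suc l)"
    by (simp add: sum_distrib_left mult.left_commute)
  also have "\<dots> = (\<Sum>l<Suc K. b l * z ^ l) - b 0"
    by (subst sum.lessThan_Suc_shift) simp
  also have "\<dots> = (\<Sum>l<K. b l * z ^ l) + b K * z ^ K - b 0" by simp
  finally show ?thesis using assms by (simp add: field_simps)
qed

context topological_group
begin

text \<open>
  The last condition bounds the oscillation of \<open>h\<close> by that of the translates of \<open>u\<close>; continuity and
  right invariance of a limit of such \<open>h\<close> are inherited from \<open>u\<close> through it.
\<close>

definition approx_eigen_pairs :: "('a \<Rightarrow> real) \<Rightarrow> 'a \<Rightarrow> real \<Rightarrow> real \<Rightarrow> (('a \<Rightarrow> complex) \<times> complex) set"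
  where "approx_eigen_pairs u g c \<epsilon> = {p.
    (\<forall>x. norm (fst p x) \<le> 1) \<and> norm (snd p) = 1 \<and> c \<le> norm (snd p - 1) \<and> c \<le> norm (fst p \<one>) \<and>
    (\<forall>x\<in>carrier G. norm (fst p (g \<otimes> x) - snd p * fst p x) \<le> \<epsilon>) \<and>
    (\<forall>x\<in>carrier G. \<forall>y\<in>carrier G. \<forall>e.
      (\<forall>a\<in>carrier G. \<bar>u (a \<otimes> x) - u (a \<otimes> y)\<bar> \<le> e) \<longrightarrow> norm (fst p x - fst p y) \<le> e)}"

lemma approx_eigen_pairs_mono: "\<epsilon> \<le> \<delta> \<Longrightarrow> approx_eigen_pairs u g c \<epsilon> \<subseteq> approx_eigen_pairs u g c \<delta>"
  by (auto simp: approx_eigen_pairs_def intro: order_trans)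

text \<open>The point is that \<open>c\<close> does not depend on \<epsilon>. Return times are
  syndetic, so the large exponential sum grows linearly in \<open>N\<close>. Up to a bounded term it
  equals \<open>(\<mu> - 1) * A \<one>\<close>; upper bounds 2 and \<open>2 * real N\<close> for the
  norms of the two factors turn into lower bounds for the other one.\<close>

lemma approx_eigen_pairs_nonempty:
  assumes comp: "compact_space \<T>" and gen: "topological_generator G \<T> g"
    and u: "continuous_map \<T> euclideanreal u" "\<And>x. x \<in> carrier G \<Longrightarrow> u x \<in> {0..1}" "u \<one> = 0" "u g = 1"
  obtains c where "0 < c" "\<And>\<epsilon>. 0 < \<epsilon> \<Longrightarrow> approx_eigen_pairs u g c \<epsilon> \<noteq> {}"
proof -
  have gc: "g \<in> carrier G" using gen by (simp add: topological_generator_def)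
  \<comment> \<open>Two perturbations below 1/8 move each of the values \<open>u g = 1\<close> and
    \<open>u \<one> = 0\<close> by less than 1/4, which leaves a difference of at least 1/2.\<close>
  obtain W where W: "openin \<T> W" "\<one> \<in> W"
    "\<And>w z. w \<in> W \<Longrightarrow> z \<in> carrier G \<Longrightarrow> dist (u (z \<otimes> w)) (u (z \<otimes> \<one>)) < 1/8"
    by (rule right_uniformly_continuous[OF comp u(1) one_closed, of "1/8"]) auto
  have W': "\<bar>u (z \<otimes> w) - u z\<bar> < 1/8" if "w \<in> W" "z \<in> carrier G" for w z
    using W(3)[OF that] that by (simp add: dist_real_def)
  obtain J :: nat where J: "0 < J" "\<And>n. \<exists>j<J. g [^] (n + j) \<in> W"
    using generator_returns_syndetic[OF comp gen W(1,2)] by blast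
  \<comment> \<open>A large coefficient of the difference sequence at \<open>z\<close> keeps \<open>z\<close> away from 1.\<close>
  define v where "v l = u (g [^] Suc l) - u (g [^] l)" for l :: nat
  have v: "1/2 \<le> v (m + n)" if "g [^] m \<in> W" "g [^] n \<in> W" for m n :: nat
  proof -
    have 1: "g [^] (m + n) = g [^] m \<otimes> g [^] n" "g [^] Suc (m + n) = (g \<otimes> g [^] m) \<otimes> g [^] n"
      using gc by (simp_all only: nat_pow_mult nat_pow_Suc2 nat_pow_closed m_assoc)
    have "\<bar>u (g [^] (m + n)) - u (g [^] m)\<bar> < 1/8" "\<bar>u (g [^] Suc (m + n)) - u (g \<otimes> g [^] m)\<bar> < 1/8"
      unfolding 1 using gc by (intro W' that(2); simp)+
    moreover have "\<bar>u (g [^] m) - u \<one>\<bar> < 1/8" "\<bar>u (g \<otimes> g [^] m) - u g\<bar> < 1/8"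
      using W'[OF that(1) one_closed] W'[OF that(1) gc] gc by simp_all
    ultimately show ?thesis using u(3,4) unfolding v_def by linarith
  qed
  \<comment> \<open>The smaller of the two bounds obtained below: \<open>1 / (8 * real J)\<close>
    for \<open>norm (\<mu> - 1)\<close> and \<open>1 / (16 * real J)\<close> for the normalised
    average at \<open>\<one>\<close>.\<close>
  define c where "c = 1 / (16 * real J)"
  show ?thesis
  proof (rule that[of c])
    show "0 < c" using J(1) by (simp add: c_def)
    fix \<epsilon> :: real assume \<epsilon>: "0 < \<epsilon>"
    \<comment> \<open>\<open>q\<close> is the number of blocks of length \<open>J\<close>. The
      summand 4 gives \<open>q / 2 - 1 \<ge> q / 4\<close>, absorbing a boundary term;
      \<open>1 / \<epsilon>\<close> brings the final error \<open>1 / q\<close> below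
      \<epsilon>.\<close>
    obtain q :: nat where q: "4 + 1 / \<epsilon> \<le> real q" using real_arch_simple by blast
    have q4: "4 \<le> real q" and q\<epsilon>: "1 / real q \<le> \<epsilon>"
    proof -
      have "0 < 1 / \<epsilon>" using \<epsilon> by simp
      then show "4 \<le> real q" using q by linarith
      then have "1 / \<epsilon> \<le> real q" "0 < real q" using q by linarith+
      then show "1 / real q \<le> \<epsilon>" using \<epsilon> by (simp add: field_simps)
    qed
    define N where "N = J * q"
    have N: "0 < N" using J(1) q4 by (simp add: N_def)
    have qN: "q \<le> N" using J(1) by (simp add: N_def)
    define S where "S = {n. n < N \<and> g [^] n \<in> W}"
    obtain j where j: "\<And>n. j n < J" "\<And>n. g [^] (n + j n) \<in> W" using J(2) by metis
    \<comment> \<open>One return time from each block \<open>{J * i ..< J * (i + 1)}\<close>.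
      Division by \<open>J\<close> recovers \<open>i\<close>, so \<open>S\<close> has at least
      \<open>q\<close> elements.\<close>
    define s where "s i = J * i + j (J * i)" for i
    have "s i div J = i" for i using J(1) j(1) by (simp add: s_def)
    then have "inj s" by (metis injI)
    moreover have "s ` {..<q} \<subseteq> S"
    proof clarify
      fix i assume "i < q"
      then have "J * Suc i \<le> N" unfolding N_def by (intro mult_le_mono) auto
      then show "s i \<in> S" using j(1)[of "J * i"] j(2)[of "J * i"] by (simp add: S_def s_def)
    qed
    ultimately have "card {..<q} \<le> card S"
      by (intro card_inj_on_le[of s]) (auto simp: S_def intro: inj_on_subset)
    then have cardS: "q \<le> card S" by simp
    have "S \<noteq> {}" using cardS q4 by auto
    moreover have "S \<subseteq> {..<N}" by (auto simp: S_def)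
    ultimately obtain z :: complex where z: "norm z = 1"
      "1/2 * card S \<le> norm (\<Sum>l<2*N. of_real (v l) * z ^ l)"
      using exists_large_exponential_sum[of S N "1/2" v] v by (auto simp: S_def)
    have z0: "z \<noteq> 0" using z(1) by auto
    define A where "A = (\<lambda>x. \<Sum>l<2*N. of_real (u (g [^] l \<otimes> x)) * z ^ l)"
    define \<mu> where "\<mu> = inverse z"
    have \<mu>1: "norm \<mu> = 1" using z(1) by (simp add: \<mu>_def norm_inverse)
    \<comment> \<open>The boundary terms left when the index of the sum is shifted by one. At
      \<open>\<one>\<close> the second vanishes because \<open>u \<one> = 0\<close>, so the bound
      there is 1 instead of 2.\<close>
    define R where "R x = \<mu> * (of_real (u (g [^] (2*N) \<otimes> x)) * z ^ (2*N) - of_real (u x))" for x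
    have shift: "(\<Sum>l<2*N. of_real (u (g [^] Suc l \<otimes> x)) * z ^ l) = \<mu> * A x + R x"
      if "x \<in> carrier G" for x
      using sum_power_shift[OF z0, of "\<lambda>l. of_real (u (g [^] l \<otimes> x))" "2*N"] that
      by (simp add: A_def \<mu>_def R_def algebra_simps)
    have unorm: "norm (complex_of_real (u x)) \<le> 1" if "x \<in> carrier G" for x
      using u(2)[OF that] by simp
    have R: "norm (R x) \<le> 2" if "x \<in> carrier G" for x
    proof -
      have "norm (R x) = norm (complex_of_real (u (g [^] (2*N) \<otimes> x)) * z ^ (2*N) - complex_of_real (u x))"
        unfolding R_def norm_mult[of \<mu>] \<mu>1 by simp
      also have "\<dots> \<le> norm (complex_of_real (u (g [^] (2*N) \<otimes> x)) * z ^ (2*N)) + norm (complex_of_real (u x))"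
        by (rule norm_triangle_ineq4)
      also have "\<dots> \<le> 1 + 1"
        using that gc z(1) by (intro add_mono unorm) (simp_all only: norm_mult norm_power power_one mult_1_right unorm m_closed nat_pow_closed)
      finally show ?thesis by simp
    qed
    have Anorm: "norm (A x) \<le> 2 * real N" if "x \<in> carrier G" for x
    proof -
      have "norm (A x) \<le> of_nat (card {..<2*N}) * (1::real)"
        unfolding A_def using that gc z(1)
        by (intro sum_norm_bound) (simp only: norm_mult norm_power power_one mult_1_right unorm m_closed nat_pow_closed)
      then show ?thesis by simp
    qed
    have "(\<Sum>l<2*N. of_real (v l) * z ^ l) = (\<mu> - 1) * A \<one> + R \<one>"
    proof -
      have "(\<Sum>l<2*N. of_real (v l) * z ^ l) =
          (\<Sum>l<2*N. of_real (u (g [^] Suc l \<otimes> \<one>)) * z ^ l) - A \<one>"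
        unfolding A_def sum_subtractf[symmetric] using gc
        by (intro sum.cong refl) (simp add: v_def left_diff_distrib)
      then show ?thesis using shift[OF one_closed] by (simp add: algebra_simps)
    qed
    then have "real q / 2 \<le> norm ((\<mu> - 1) * A \<one> + R \<one>)"
      using z(2) cardS by simp
    also have "\<dots> \<le> norm (\<mu> - 1) * norm (A \<one>) + norm (R \<one>)"
      by (metis norm_mult norm_triangle_ineq)
    also have "norm (R \<one>) \<le> 1"
    proof -
      have "norm (R \<one>) = norm (complex_of_real (u (g [^] (2*N))))"
        using gc \<mu>1 z(1) u(3) by (simp add: R_def norm_mult norm_power del: norm_of_real)
      then show ?thesis using unorm[of "g [^] (2*N)"] gc by simp
    qed
    finally have key: "real q / 4 \<le> norm (\<mu> - 1) * norm (A \<one>)" using q4 by linarith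
    have NJq: "real N = real J * real q" by (simp add: N_def)
    have "norm (\<mu> - 1) * norm (A \<one>) \<le> norm (\<mu> - 1) * (2 * real N)"
      using Anorm by (intro mult_left_mono) auto
    then have "real q * 1 \<le> real q * (8 * real J * norm (\<mu> - 1))"
      using key by (simp add: NJq mult_ac)
    then have \<mu>c: "1 \<le> 8 * real J * norm (\<mu> - 1)"
      using q4 by (subst (asm) mult_le_cancel_left_pos) auto
    have "norm (\<mu> - 1) \<le> 2" using norm_triangle_ineq4[of \<mu> 1] \<mu>1 by simp
    then have "norm (\<mu> - 1) * norm (A \<one>) \<le> 2 * norm (A \<one>)" by (intro mult_right_mono) auto
    then have A1: "real q / 8 \<le> norm (A \<one>)" using key by linarith
    define r where "r = 1 / (2 * real N)"
    have r: "0 < r" "r * (2 * real N) = 1" using N by (simp_all add: r_def)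
    \<comment> \<open>a Fourier coefficient at \<open>z\<close> of the translates of \<open>u\<close> along the orbit of \<open>g\<close>\<close>
    define h where "h x = (if x \<in> carrier G then of_real r * A x else 0)" for x
    have norm_r: "norm (of_real r * w) = r * norm w" for w :: complex
      using r(1) by (simp add: norm_mult)
    have "(h, \<mu>) \<in> approx_eigen_pairs u g c \<epsilon>"
      unfolding approx_eigen_pairs_def mem_Collect_eq fst_conv snd_conv
    proof (intro conjI allI ballI impI)
      show "norm (h x) \<le> 1" for x
        using mult_left_mono[OF Anorm[of x] less_imp_le[OF r(1)]] r(2) by (simp add: h_def norm_r)
      show "norm \<mu> = 1" by fact
      show "c \<le> norm (\<mu> - 1)" using \<mu>c J(1) by (simp add: c_def field_simps)
      have "c = r * (real q / 8)" using J(1) q4 by (simp add: c_def r_def NJq)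
      then show "c \<le> norm (h \<one>)"
        using mult_left_mono[OF A1 less_imp_le[OF r(1)]] by (simp add: h_def norm_r)
    next
      fix x assume x: "x \<in> carrier G"
      have "A (g \<otimes> x) = (\<Sum>l<2*N. of_real (u (g [^] Suc l \<otimes> x)) * z ^ l)"
        unfolding A_def using gc x by (intro sum.cong refl) (simp add: m_assoc)
      then have "h (g \<otimes> x) - \<mu> * h x = of_real r * R x"
        using x gc shift[OF x] by (simp add: h_def algebra_simps)
      then have "norm (h (g \<otimes> x) - \<mu> * h x) \<le> r * 2"
        using R[OF x] r(1) by (simp only: norm_r) (intro mult_left_mono, auto)
      also have "\<dots> \<le> 1 / real q" using qN q4 N by (simp add: r_def frac_le)
      finally show "norm (h (g \<otimes> x) - \<mu> * h x) \<le> \<epsilon>" using q\<epsilon> by linarith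
    next
      fix x y e assume x: "x \<in> carrier G" and y: "y \<in> carrier G"
        and e: "\<forall>a\<in>carrier G. \<bar>u (a \<otimes> x) - u (a \<otimes> y)\<bar> \<le> e"
      have "A x - A y = (\<Sum>l<2*N. of_real (u (g [^] l \<otimes> x) - u (g [^] l \<otimes> y)) * z ^ l)"
        by (simp add: A_def left_diff_distrib sum_subtractf)
      also have "norm \<dots> \<le> of_nat (card {..<2*N}) * e"
        using e gc z(1) by (intro sum_norm_bound) (simp add: norm_mult norm_power del: of_real_diff)
      finally have "norm (A x - A y) \<le> 2 * real N * e" by simp
      from mult_left_mono[OF this less_imp_le[OF r(1)]]
      have "norm (of_real r * (A x - A y)) \<le> (r * (2 * real N)) * e"
        by (simp add: norm_r mult.assoc)
      then show "norm (h x - h y) \<le> e"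
        using x y r(2) by (simp add: h_def right_diff_distrib)
    qed
    then show "approx_eigen_pairs u g c \<epsilon> \<noteq> {}" by blast
  qed
qed

text \<open>Every condition is closed under pointwise convergence, as it involves finitely many
  values of the function. The premise of the oscillation condition does not mention the pair, so it
  defines an open set, everything or nothing.\<close>

lemma closed_approx_eigen_pairs: "closed (approx_eigen_pairs u g c \<epsilon>)"
proof -
  have cont: "continuous_on UNIV (\<lambda>p :: ('a \<Rightarrow> complex) \<times> complex. fst p x)" for x
    by (rule continuous_on_product_then_coordinatewise) (intro continuous_intros)
  have const: "open {p :: ('a \<Rightarrow> complex) \<times> complex. P}" for P by simp
  show ?thesis
    unfolding approx_eigen_pairs_def Ball_def
    by (intro closed_Collect_conj closed_Collect_all closed_Collect_imp const closed_Collect_le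
        closed_Collect_eq continuous_intros cont)
qed

text \<open>Tychonoff for closed discs. The product runs over the whole type, which is why
  approximate eigenfunctions are bounded off the carrier as well.\<close>

lemma compact_bounded_pairs:
  "compact {p :: ('a \<Rightarrow> complex) \<times> complex. (\<forall>x. norm (fst p x) \<le> 1) \<and> norm (snd p) = 1}"
proof -
  have "compactin (product_topology (\<lambda>_. euclidean) UNIV) (PiE UNIV (\<lambda>_::'a. cball (0::complex) 1))"
    by (simp add: compactin_PiE)
  then have "compact (PiE UNIV (\<lambda>_::'a. cball (0::complex) 1))"
    by (simp add: euclidean_product_topology)
  from compact_Times[OF this compact_sphere[of "0::complex" 1]] show ?thesis
    by (rule back_subst[of compact]) (auto simp: PiE_def Pi_def)
qed

text \<open>A pair that is approximate for every tolerance satisfies the eigenvalue equation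
  exactly. The oscillation condition transfers continuity and right \<open>H\<close>-invariance from
  \<open>u\<close>; density of the powers of \<open>g\<close> makes the modulus of \<open>h\<close>
  constant, hence nonzero.\<close>

lemma exists_eigenfunction:
  assumes comp: "compact_space \<T>" and "Hausdorff_space \<T>" and gen: "topological_generator G \<T> g"
    and H: "closedin \<T> H" "subgroup H G" "g \<notin> H"
  obtains h :: "'a \<Rightarrow> complex" and \<mu> where "continuous_map \<T> euclidean h" "norm \<mu> = 1" "\<mu> \<noteq> 1"
    "\<And>x. x \<in> carrier G \<Longrightarrow> h x \<noteq> 0" "\<And>x. x \<in> carrier G \<Longrightarrow> h (g \<otimes> x) = \<mu> * h x"
    "\<And>x s. x \<in> carrier G \<Longrightarrow> s \<in> H \<Longrightarrow> h (x \<otimes> s) = h x"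
proof -
  have gc: "g \<in> carrier G" and dense: "\<T> closure_of {g [^] n |n::nat. True} = carrier G"
    using gen topspace_eq_carrier by (auto simp: topological_generator_def dense_in_def)
  obtain u :: "'a \<Rightarrow> real" where u: "continuous_map \<T> euclideanreal u"
    "\<And>x. x \<in> carrier G \<Longrightarrow> u x \<in> {0..1}" "u \<one> = 0" "u g = 1"
    and uH: "\<And>x s. x \<in> carrier G \<Longrightarrow> s \<in> H \<Longrightarrow> u (x \<otimes> s) = u x"
    by (rule exists_right_invariant_separating[OF assms(1,2) H(1,2) gc H(3)]) (rule that)
  obtain c where c: "0 < c" and ne: "\<And>\<epsilon>. 0 < \<epsilon> \<Longrightarrow> approx_eigen_pairs u g c \<epsilon> \<noteq> {}"
    by (rule approx_eigen_pairs_nonempty[OF comp gen u]) (assumption, rule that)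
  let ?K = "{p :: ('a \<Rightarrow> complex) \<times> complex. (\<forall>x. norm (fst p x) \<le> 1) \<and> norm (snd p) = 1}"
  have sub: "approx_eigen_pairs u g c \<epsilon> \<subseteq> ?K" for \<epsilon> by (auto simp: approx_eigen_pairs_def)
  \<comment> \<open>The sets shrink with the tolerance, so a finite intersection contains the
    nonempty one with the largest index.\<close>
  have "?K \<inter> (\<Inter>n. approx_eigen_pairs u g c (inverse (Suc n))) \<noteq> {}"
  proof (rule compact_imp_fip_image[OF compact_bounded_pairs closed_approx_eigen_pairs])
    fix I :: "nat set" assume I: "finite I"
    define m where "m = Max (insert 0 I)"
    have "approx_eigen_pairs u g c (inverse (Suc m)) \<subseteq> approx_eigen_pairs u g c (inverse (Suc n))"
      if "n \<in> I" for n
    proof (rule approx_eigen_pairs_mono)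
      have "n \<le> m" using I that by (simp add: m_def)
      then show "inverse (real (Suc m)) \<le> inverse (real (Suc n))" by (simp add: field_simps)
    qed
    then have "approx_eigen_pairs u g c (inverse (Suc m)) \<subseteq>
        ?K \<inter> (\<Inter>n\<in>I. approx_eigen_pairs u g c (inverse (Suc n)))"
      using sub by (intro Int_greatest INT_greatest)
    moreover have "approx_eigen_pairs u g c (inverse (Suc m)) \<noteq> {}" by (rule ne) simp
    ultimately show "?K \<inter> (\<Inter>n\<in>I. approx_eigen_pairs u g c (inverse (Suc n))) \<noteq> {}"
      by (metis subset_empty)
  qed
  then obtain p where p: "p \<in> approx_eigen_pairs u g c (inverse (Suc n))" for n by blast
  define h where "h = fst p"
  define \<mu> where "\<mu> = snd p"
  have \<mu>1: "norm \<mu> = 1" and \<mu>c: "c \<le> norm (\<mu> - 1)" and h1: "c \<le> norm (h \<one>)"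
    and approx: "\<And>x n. x \<in> carrier G \<Longrightarrow> norm (h (g \<otimes> x) - \<mu> * h x) \<le> inverse (Suc n)"
    and osc: "\<And>x y e. \<lbrakk>x \<in> carrier G; y \<in> carrier G; \<And>a. a \<in> carrier G \<Longrightarrow> \<bar>u (a \<otimes> x) - u (a \<otimes> y)\<bar> \<le> e\<rbrakk>
      \<Longrightarrow> norm (h x - h y) \<le> e"
    using p unfolding approx_eigen_pairs_def mem_Collect_eq h_def[symmetric] \<mu>_def[symmetric]
    by blast+
  have eigen: "h (g \<otimes> x) = \<mu> * h x" if x: "x \<in> carrier G" for x
  proof (rule ccontr)
    assume "\<not> ?thesis"
    then obtain n where "inverse (Suc n) < norm (h (g \<otimes> x) - \<mu> * h x)"
      using reals_Archimedean[of "norm (h (g \<otimes> x) - \<mu> * h x)"] by auto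
    then show False using approx[OF x, of n] by linarith
  qed
  have cont: "continuous_map \<T> euclidean h"
  proof (rule continuous_map_euclidean_distI)
    fix x and e :: real assume x: "x \<in> topspace \<T>" and e: "0 < e"
    then have xc: "x \<in> carrier G" using topspace_eq_carrier by simp
    obtain W where W: "openin \<T> W" "x \<in> W"
      "\<And>w z. w \<in> W \<Longrightarrow> z \<in> carrier G \<Longrightarrow> dist (u (z \<otimes> w)) (u (z \<otimes> x)) < e/2"
      by (rule right_uniformly_continuous[OF comp u(1) xc half_gt_zero[OF e]]) (rule that)
    have "dist (h y) (h x) < e" if y: "y \<in> W" for y
    proof -
      have "y \<in> carrier G" using y openin_subset[OF W(1)] topspace_eq_carrier by auto
      then have "norm (h y - h x) \<le> e/2"
        using W(3)[OF y] by (intro osc xc) (auto simp: dist_real_def intro: less_imp_le)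
      then show ?thesis using e by (simp add: dist_norm)
    qed
    then show "\<exists>U. openin \<T> U \<and> x \<in> U \<and> (\<forall>y\<in>U. dist (h y) (h x) < e)"
      using W by blast
  qed
  have pow: "norm (h (g [^] n)) = norm (h \<one>)" for n :: nat
  proof (induction n)
    case (Suc n)
    have "h (g [^] Suc n) = \<mu> * h (g [^] n)"
      using gc by (simp only: nat_pow_Suc2 eigen nat_pow_closed)
    then show ?case using Suc \<mu>1 by (simp add: norm_mult)
  qed simp
  show ?thesis
  proof (rule that[OF cont \<mu>1 _ _ eigen])
    show "\<mu> \<noteq> 1" using \<mu>c c by auto
    show "h x \<noteq> 0" if "x \<in> carrier G" for x
    proof -
      have "continuous_map \<T> euclideanreal (\<lambda>x. norm (h x))"
        using cont by (intro continuous_intros)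
      then have "closedin \<T> {x \<in> topspace \<T>. norm (h x) \<in> {norm (h \<one>)}}"
        by (rule closedin_continuous_map_preimage) simp
      moreover have "{g [^] n |n::nat. True} \<subseteq> {x \<in> topspace \<T>. norm (h x) \<in> {norm (h \<one>)}}"
        using pow gc topspace_eq_carrier by auto
      ultimately have "\<T> closure_of {g [^] n |n::nat. True} \<subseteq> {x \<in> topspace \<T>. norm (h x) \<in> {norm (h \<one>)}}"
        by (intro closure_of_minimal)
      then have "norm (h x) = norm (h \<one>)" unfolding dense using that by auto
      then show ?thesis using h1 c by auto
    qed
    fix x s assume x: "x \<in> carrier G" and s: "s \<in> H"
    have sc: "s \<in> carrier G" using s H(2) subgroup.mem_carrier by metis
    \<comment> \<open>The oscillation bound with \<open>e = 0\<close>: all left translates of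
      \<open>u\<close> agree at \<open>x \<otimes> s\<close> and \<open>x\<close>.\<close>
    have "norm (h (x \<otimes> s) - h x) \<le> 0"
    proof (rule osc)
      fix a assume "a \<in> carrier G"
      then show "\<bar>u (a \<otimes> (x \<otimes> s)) - u (a \<otimes> x)\<bar> \<le> 0"
        using x s sc uH[of "a \<otimes> x" s] by (simp add: m_assoc)
    qed (use x sc in auto)
    then show "h (x \<otimes> s) = h x" by simp
  qed
qed

end

section \<open>Joint orbit closures\<close>

context topological_group
begin

definition joint_orbit_closure :: "'c topology \<Rightarrow> ('c \<Rightarrow> 'c) \<Rightarrow> 'a \<Rightarrow> 'c \<Rightarrow> ('c \<times> 'a) set" where
  "joint_orbit_closure X T g x = prod_topology X \<T> closure_of {((T ^^ n) x, g [^] n) | n :: nat. True}"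

lemma closedin_joint_orbit_closure: "closedin (prod_topology X \<T>) (joint_orbit_closure X T g x)"
  by (simp add: joint_orbit_closure_def)

lemma joint_orbit_closure_in_topspace:
  assumes "(y, a) \<in> joint_orbit_closure X T g x"
  shows "y \<in> topspace X" "a \<in> carrier G"
  using closedin_subset[OF closedin_joint_orbit_closure[of X T g x]] assms topspace_eq_carrier by auto

lemma funpow_in_topspace: "continuous_map X X T \<Longrightarrow> x \<in> topspace X \<Longrightarrow> (T ^^ n) x \<in> topspace X"
  by (induction n) (auto simp: continuous_map_def)

lemma joint_orbit_subset_closure:
  assumes "continuous_map X X T" "g \<in> carrier G" "x \<in> topspace X"
  shows "((T ^^ n) x, g [^] n) \<in> joint_orbit_closure X T g x"
proof -
  have "{((T ^^ n) x, g [^] n) | n :: nat. True} \<subseteq> topspace (prod_topology X \<T>)"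
    using funpow_in_topspace[OF assms(1,3)] assms(2) topspace_eq_carrier by auto
  from closure_of_subset[OF this] show ?thesis
    unfolding joint_orbit_closure_def by blast
qed

lemma joint_orbit_closure_step:
  assumes T: "continuous_map X X T" and g: "g \<in> carrier G"
    and ya: "(y, a) \<in> joint_orbit_closure X T g x"
  shows "(T y, g \<otimes> a) \<in> joint_orbit_closure X T g x"
proof -
  let ?P = "prod_topology X \<T>" and ?O = "{((T ^^ n) x, g [^] n) | n :: nat. True}"
  let ?S = "\<lambda>p. (T (fst p), g \<otimes> snd p)"
  have "continuous_map ?P X (\<lambda>p. T (fst p))"
    using continuous_map_compose[OF continuous_map_fst T] by (simp add: o_def)
  moreover have "continuous_map ?P \<T> (\<lambda>p. g \<otimes> snd p)"
    using continuous_map_compose[OF continuous_map_snd continuous_map_lmult[OF g]] by (simp add: o_def)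
  ultimately have "continuous_map ?P ?P ?S" by (rule continuous_map_pairedI)
  then have "?S ` (?P closure_of ?O) \<subseteq> ?P closure_of (?S ` ?O)"
    by (rule continuous_map_image_closure_subset)
  also have "?S ` ?O \<subseteq> ?O"
  proof clarify
    fix n
    have "(T (fst ((T ^^ n) x, g [^] n)), g \<otimes> snd ((T ^^ n) x, g [^] n)) = ((T ^^ Suc n) x, g [^] Suc n)"
      using g by (simp add: nat_pow_Suc2[symmetric] del: nat_pow_Suc)
    then show "\<exists>m. (T (fst ((T ^^ n) x, g [^] n)), g \<otimes> snd ((T ^^ n) x, g [^] n)) = ((T ^^ m) x, g [^] m) \<and> True"
      by blast
  qed
  then have "?P closure_of (?S ` ?O) \<subseteq> ?P closure_of ?O" by (rule closure_of_mono)
  finally have "?S ` joint_orbit_closure X T g x \<subseteq> joint_orbit_closure X T g x"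
    unfolding joint_orbit_closure_def .
  from subsetD[OF this imageI[OF ya]] show ?thesis by simp
qed

text \<open>Right multiplication by \<open>a\<close> commutes with left multiplication by
  \<open>g\<close>. It therefore carries the joint orbit of \<open>y\<close> to the orbit of
  \<open>(y, a)\<close>, which stays in the closed invariant set of \<open>x\<close>.\<close>

lemma joint_orbit_closure_trans:
  assumes T: "continuous_map X X T" and g: "g \<in> carrier G"
    and ya: "(y, a) \<in> joint_orbit_closure X T g x" and zb: "(z, b) \<in> joint_orbit_closure X T g y"
  shows "(z, b \<otimes> a) \<in> joint_orbit_closure X T g x"
proof -
  let ?P = "prod_topology X \<T>" and ?O = "{((T ^^ n) y, g [^] n) | n :: nat. True}"
  let ?R = "\<lambda>p. (fst p, snd p \<otimes> a)"
  note a = joint_orbit_closure_in_topspace(2)[OF ya]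
  have orbit: "((T ^^ n) y, g [^] n \<otimes> a) \<in> joint_orbit_closure X T g x" for n :: nat
  proof (induction n)
    case (Suc n)
    have "g [^] Suc n \<otimes> a = g \<otimes> (g [^] n \<otimes> a)"
      using g a by (simp only: nat_pow_Suc2 m_assoc nat_pow_closed)
    with joint_orbit_closure_step[OF T g Suc] show ?case by (simp only: funpow.simps o_apply)
  qed (use ya a in simp)
  have "continuous_map ?P \<T> (\<lambda>p. snd p \<otimes> a)"
    using continuous_map_compose[OF continuous_map_snd continuous_map_rmult[OF a]] by (simp add: o_def)
  then have "continuous_map ?P ?P ?R" by (intro continuous_map_pairedI continuous_map_fst)
  then have "?R ` (?P closure_of ?O) \<subseteq> ?P closure_of (?R ` ?O)"
    by (rule continuous_map_image_closure_subset)
  also have "\<dots> \<subseteq> joint_orbit_closure X T g x"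
    using orbit by (intro closure_of_minimal closedin_joint_orbit_closure) auto
  finally have "?R ` joint_orbit_closure X T g y \<subseteq> joint_orbit_closure X T g x"
    unfolding joint_orbit_closure_def[of X T g y] .
  from subsetD[OF this imageI[OF zb]] show ?thesis by simp
qed

text \<open>Projection along the compact group is closed, so the projected closure is a closed set
  containing the dense orbit of \<open>x\<close>.\<close>

lemma joint_orbit_closure_surj:
  assumes comp: "compact_space \<T>" and T: "continuous_map X X T" and g: "g \<in> carrier G"
    and x: "x \<in> universal_elements X T" and z: "z \<in> topspace X"
  obtains a where "(z, a) \<in> joint_orbit_closure X T g x"
proof -
  have xX: "x \<in> topspace X" and dense: "X closure_of (orbit_of T x) = topspace X"
    using x by (auto simp: universal_elements_def dense_in_def)
  have "closedin X (fst ` joint_orbit_closure X T g x)"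
    using closed_map_fst[OF comp, of X] closedin_joint_orbit_closure[of X T g x]
    by (simp add: closed_map_def)
  moreover have "orbit_of T x \<subseteq> fst ` joint_orbit_closure X T g x"
  proof
    fix y assume "y \<in> orbit_of T x"
    then obtain n where "y = (T ^^ n) x" by (auto simp: orbit_of_def)
    then show "y \<in> fst ` joint_orbit_closure X T g x"
      by (intro image_eqI[where x = "((T ^^ n) x, g [^] n)"] joint_orbit_subset_closure T g xX) simp
  qed
  ultimately have "X closure_of (orbit_of T x) \<subseteq> fst ` joint_orbit_closure X T g x"
    by (intro closure_of_minimal)
  then obtain p where "p \<in> joint_orbit_closure X T g x" "z = fst p"
    using z unfolding dense by blast
  then show ?thesis by (intro that[of "snd p"]) simp
qed

text \<open>Transitivity from \<open>x\<close> to \<open>x\<close> gives a closed submonoid;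
  compactness then supplies the inverses.\<close>

lemma subgroup_joint_orbit_closure_fibre:
  assumes comp: "compact_space \<T>" and T: "continuous_map X X T" and g: "g \<in> carrier G"
    and x: "x \<in> topspace X"
  defines "H \<equiv> {a \<in> carrier G. (x, a) \<in> joint_orbit_closure X T g x}"
  shows "closedin \<T> H" "subgroup H G"
proof -
  have "continuous_map \<T> (prod_topology X \<T>) (\<lambda>a. (x, a))"
    using x by (intro continuous_map_pairedI) auto
  from closedin_continuous_map_preimage[OF this closedin_joint_orbit_closure]
  show closed: "closedin \<T> H" by (simp add: H_def topspace_eq_carrier)
  have one: "\<one> \<in> H"
    using joint_orbit_subset_closure[OF T g x, of 0] by (simp add: H_def)
  have mult: "a \<otimes> b \<in> H" if "a \<in> H" "b \<in> H" for a b
    using that joint_orbit_closure_trans[OF T g, of x b x x a] by (simp add: H_def)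
  have "inv a \<in> H" if "a \<in> H" for a
    by (rule closed_submonoid_inv_closed[OF comp closed one mult that])
  then show "subgroup H G"
    using one mult by unfold_locales (auto simp: H_def)
qed

end

section \<open>Fibres over \<open>Y\<close> and density of the joint orbit\<close>

theorem theorem1p1:
  fixes X :: "'a topology" and T :: "'a \<Rightarrow> 'a" and Y :: "'a set"
    and G :: "('g, 'm) monoid_scheme" and \<T> :: "'g topology" and g :: 'g
  assumes "Hausdorff_space X"
    and "continuous_map X X T"
    and "topological_group G \<T>"
    and "Hausdorff_space \<T>"
    and "compact_space \<T>"
    and "topological_generator G \<T> g"
    and "Y \<noteq> {}"
    and "Y \<subseteq> universal_elements X T"
    and "T ` Y \<subseteq> Y"
    and "path_connected_space (subtopology X Y)"
    and "locally_path_connected_space (subtopology X Y)"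
    and "simply_connected_space (subtopology X Y)"
  shows "\<forall>x \<in> Y. dense_in (prod_topology X \<T>) {((T ^^ n) x, g [^]\<^bsub>G\<^esub> n) | n :: nat. True}"
proof
  fix x assume x: "x \<in> Y"
  interpret topological_group G \<T> by fact
  note T = assms(2) and comp = assms(5) and gen = assms(6)
  have gc: "g \<in> carrier G" and g_dense: "\<T> closure_of {g [^]\<^bsub>G\<^esub> n |n::nat. True} = carrier G"
    using gen topspace_eq_carrier by (auto simp: topological_generator_def dense_in_def)
  have YX: "Y \<subseteq> topspace X" using assms(8) by (auto simp: universal_elements_def)
  have dense: "X closure_of (orbit_of T y) = topspace X" if "y \<in> Y" for y
    using assms(8) that by (auto simp: universal_elements_def dense_in_def)
  have xX: "x \<in> topspace X" using x YX by blast
  have TY: "(T ^^ n) y \<in> Y" if "y \<in> Y" for n y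
    using that assms(9) by (induction n) auto
  define C where "C = joint_orbit_closure X T g"
  have surj: "\<exists>a. (z, a) \<in> C y" if "y \<in> Y" "z \<in> topspace X" for y z
    using joint_orbit_closure_surj[OF comp T gc _ that(2)] assms(8) that(1) unfolding C_def by blast
  note trans = joint_orbit_closure_trans[OF T gc, folded C_def]
  note carr = joint_orbit_closure_in_topspace(2)[of _ _ X T g, folded C_def]
  define H where "H = {a \<in> carrier G. (x, a) \<in> C x}"
  have H: "closedin \<T> H" "subgroup H G"
    using subgroup_joint_orbit_closure_fibre[OF comp T gc xX] by (simp_all add: H_def C_def)
  have mem_H: "a \<in> H \<longleftrightarrow> (x, a) \<in> C x" for a
    unfolding H_def using carr by blast
  interpret H: subgroup H G by fact
  have "g \<in> H"
  proof (rule ccontr)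
    assume gH: "g \<notin> H"
    obtain h :: "'g \<Rightarrow> complex" and \<mu> where h: "continuous_map \<T> euclidean h"
      and \<mu>: "\<mu> \<noteq> 1"
      and hnz: "\<And>x. x \<in> carrier G \<Longrightarrow> h x \<noteq> 0"
      and hg: "\<And>x. x \<in> carrier G \<Longrightarrow> h (g \<otimes>\<^bsub>G\<^esub> x) = \<mu> * h x"
      and hH: "\<And>x s. x \<in> carrier G \<Longrightarrow> s \<in> H \<Longrightarrow> h (x \<otimes>\<^bsub>G\<^esub> s) = h x"
      by (rule exists_eigenfunction[OF comp assms(4) gen H gH]) (rule that)
    \<comment> \<open>Universality of \<open>y\<close> provides a \<open>c\<close> leading back from
      \<open>y\<close> to \<open>x\<close>. Both \<open>c \<otimes> a\<close> and
      \<open>c \<otimes> b\<close> then lie in \<open>H\<close>, so \<open>b\<close> lies in the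
      left coset of \<open>a\<close>.\<close>
    have coset: "h a = h b" if y: "y \<in> Y" and a: "(y, a) \<in> C x" and b: "(y, b) \<in> C x" for y a b
    proof -
      obtain c where c: "(x, c) \<in> C y" using surj[OF y xX] by blast
      note [simp] = carr[OF a] carr[OF b] carr[OF c]
      have "c \<otimes>\<^bsub>G\<^esub> a \<in> H" "c \<otimes>\<^bsub>G\<^esub> b \<in> H"
        unfolding mem_H by (rule trans[OF a c], rule trans[OF b c])
      then have "inv\<^bsub>G\<^esub> (c \<otimes>\<^bsub>G\<^esub> a) \<otimes>\<^bsub>G\<^esub> (c \<otimes>\<^bsub>G\<^esub> b) \<in> H"
        by (rule H.m_closed[OF H.m_inv_closed])
      moreover have "a \<otimes>\<^bsub>G\<^esub> (inv\<^bsub>G\<^esub> (c \<otimes>\<^bsub>G\<^esub> a) \<otimes>\<^bsub>G\<^esub> (c \<otimes>\<^bsub>G\<^esub> b)) = b"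
      proof -
        have "inv\<^bsub>G\<^esub> c \<otimes>\<^bsub>G\<^esub> (c \<otimes>\<^bsub>G\<^esub> b) = b" "a \<otimes>\<^bsub>G\<^esub> (inv\<^bsub>G\<^esub> a \<otimes>\<^bsub>G\<^esub> b) = b"
          by (simp_all add: m_assoc[symmetric])
        then show ?thesis by (simp add: inv_mult_group m_assoc)
      qed
      ultimately show ?thesis using hH[of a] by (metis carr[OF a])
    qed
    \<comment> \<open>The fibre of \<open>C x\<close> over \<open>y\<close> lies in one coset of \<open>H\<close>, where \<open>h\<close> is constant.\<close>
    define f where "f y = h (SOME a. (y, a) \<in> C x)" for y
    have f: "f y = h a" if "y \<in> Y" "(y, a) \<in> C x" for y a
      unfolding f_def by (rule coset[OF that(1) someI that(2)]) (rule that(2))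
    have fex: "\<exists>a. (y, a) \<in> C x \<and> f y = h a" if "y \<in> Y" for y
      using surj[OF x, of y] f[OF that] that YX by blast
    have top_Y: "topspace (subtopology X Y) = Y" using YX by auto
    \<comment> \<open>Any point of the fibre may replace the chosen one, so the preimage of a closed
      set is the trace on \<open>Y\<close> of a closed set projected along the compact
      group.\<close>
    have "continuous_map (subtopology X Y) euclidean f"
      unfolding continuous_map_closedin
    proof (intro conjI allI impI)
      fix D :: "complex set" assume D: "closedin euclidean D"
      have "continuous_map (prod_topology X \<T>) euclidean (\<lambda>p. h (snd p))"
        using continuous_map_compose[OF continuous_map_snd h] by (simp add: o_def)
      from closedin_continuous_map_preimage[OF this D]
      have "closedin (prod_topology X \<T>) (C x \<inter> {p \<in> topspace (prod_topology X \<T>). h (snd p) \<in> D})"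
        using closedin_joint_orbit_closure unfolding C_def by (intro closedin_Int)
      then have "closedin X (fst ` (C x \<inter> {p \<in> topspace (prod_topology X \<T>). h (snd p) \<in> D}))"
        using closed_map_fst[OF comp, of X] by (simp add: closed_map_def)
      moreover have "{y \<in> topspace (subtopology X Y). f y \<in> D} =
          fst ` (C x \<inter> {p \<in> topspace (prod_topology X \<T>). h (snd p) \<in> D}) \<inter> Y"
      proof (intro equalityI subsetI)
        fix y assume "y \<in> {y \<in> topspace (subtopology X Y). f y \<in> D}"
        then have y: "y \<in> Y" "f y \<in> D" by auto
        obtain a where a: "(y, a) \<in> C x" "f y = h a" using fex[OF y(1)] by blast
        then have "(y, a) \<in> C x \<inter> {p \<in> topspace (prod_topology X \<T>). h (snd p) \<in> D}"
          using y YX carr[OF a(1)] topspace_eq_carrier by auto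
        then show "y \<in> fst ` (C x \<inter> {p \<in> topspace (prod_topology X \<T>). h (snd p) \<in> D}) \<inter> Y"
          using y(1) by (intro IntI[OF image_eqI[where x = "(y, a)"]]) simp_all
      next
        fix y assume "y \<in> fst ` (C x \<inter> {p \<in> topspace (prod_topology X \<T>). h (snd p) \<in> D}) \<inter> Y"
        then obtain a where "y \<in> Y" "(y, a) \<in> C x" "h a \<in> D" by auto
        then show "y \<in> {y \<in> topspace (subtopology X Y). f y \<in> D}"
          using f YX by auto
      qed
      ultimately show "closedin (subtopology X Y) {y \<in> topspace (subtopology X Y). f y \<in> D}"
        unfolding closedin_subtopology by blast
    qed simp
    moreover have "continuous_map (subtopology X Y) (subtopology X Y) T"
      using T assms(9) by (auto simp: continuous_map_in_subtopology continuous_map_from_subtopology)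
    moreover have "f y \<noteq> 0" if "y \<in> topspace (subtopology X Y)" for y
      using fex[of y] that hnz carr by (metis top_Y)
    moreover have "f (T y) = \<mu> * f y" if "y \<in> topspace (subtopology X Y)" for y
    proof -
      have y: "y \<in> Y" using that by simp
      obtain a where a: "(y, a) \<in> C x" "f y = h a" using fex[OF y] by blast
      have "(T y, g \<otimes>\<^bsub>G\<^esub> a) \<in> C x"
        using joint_orbit_closure_step[OF T gc] a(1) unfolding C_def by blast
      then have "f (T y) = h (g \<otimes>\<^bsub>G\<^esub> a)" using TY[OF y, of 1] by (intro f) auto
      then show ?thesis using hg[OF carr[OF a(1)]] a(2) by simp
    qed
    \<comment> \<open>Density is used for the orbit of \<open>T x\<close>, again a point of
      \<open>Y\<close>, so that the return time of \<open>x\<close> is positive.\<close>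
    moreover have "\<exists>n>0. (T ^^ n) x \<in> U" if U: "openin (subtopology X Y) U" "x \<in> U" for U
    proof -
      obtain V where V: "openin X V" "U = V \<inter> Y" using U(1) by (auto simp: openin_subtopology)
      have "x \<in> X closure_of (orbit_of T (T x))"
        using dense[of "T x"] TY[OF x, of 1] xX by simp
      then obtain y where "y \<in> orbit_of T (T x)" "y \<in> V"
        using V U(2) unfolding in_closure_of by blast
      then obtain n where "(T ^^ n) (T x) \<in> V" by (auto simp: orbit_of_def)
      then have "(T ^^ Suc n) x \<in> V" by (simp add: funpow_swap1)
      then have "(T ^^ Suc n) x \<in> U" using TY[OF x] V(2) by blast
      then show ?thesis by blast
    qed
    ultimately have "\<mu> = 1"
      using no_eigenfunction_on_simply_connected[OF assms(10-12)] x top_Y by metis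
    then show False using \<mu> by simp
  qed
  have "{g [^]\<^bsub>G\<^esub> n |n::nat. True} \<subseteq> H"
  proof clarify
    show "g [^]\<^bsub>G\<^esub> n \<in> H" for n :: nat
      by (induction n) (use \<open>g \<in> H\<close> in auto)
  qed
  then have "carrier G \<subseteq> H"
    using closure_of_minimal[OF _ H(1)] g_dense by blast
  \<comment> \<open>Now \<open>H\<close> is the whole group: from one point \<open>b\<close> of a
    fibre, right multiplication by \<open>inv b \<otimes> a\<close> reaches every
    \<open>a\<close>.\<close>
  have "Y \<times> carrier G \<subseteq> C x"
  proof clarify
    fix y a assume y: "y \<in> Y" and a: "a \<in> carrier G"
    obtain b where b: "(y, b) \<in> C x" using surj[OF x] y YX by blast
    have "inv\<^bsub>G\<^esub> b \<otimes>\<^bsub>G\<^esub> a \<in> H"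
      using a carr[OF b] by (intro subsetD[OF \<open>carrier G \<subseteq> H\<close>] m_closed inv_closed)
    then have "(y, b \<otimes>\<^bsub>G\<^esub> (inv\<^bsub>G\<^esub> b \<otimes>\<^bsub>G\<^esub> a)) \<in> C x" 
      unfolding mem_H by (rule trans[OF _ b])
    then show "(y, a) \<in> C x" using a carr[OF b] by (simp add: m_assoc[symmetric])
  qed
  then have "prod_topology X \<T> closure_of (Y \<times> carrier G) \<subseteq> C x"
    using closedin_joint_orbit_closure unfolding C_def by (intro closure_of_minimal)
  moreover have "X closure_of Y = topspace X"
  proof -
    have "orbit_of T x \<subseteq> Y" using TY[OF x] by (auto simp: orbit_of_def)
    then show ?thesis
      using dense[OF x] closure_of_mono closure_of_subset_topspace by (metis subset_antisym)
  qed
  moreover have "\<T> closure_of carrier G = topspace \<T>"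
    using closure_of_topspace[of \<T>] by (simp add: topspace_eq_carrier)
  ultimately have "C x = topspace (prod_topology X \<T>)"
    using closedin_subset[OF closedin_joint_orbit_closure, of X T g x]
    by (simp add: closure_of_Times C_def)
  moreover have "{((T ^^ n) x, g [^]\<^bsub>G\<^esub> n) | n :: nat. True} \<subseteq> topspace (prod_topology X \<T>)"
    using funpow_in_topspace[OF T xX] gc topspace_eq_carrier by auto
  ultimately show "dense_in (prod_topology X \<T>) {((T ^^ n) x, g [^]\<^bsub>G\<^esub> n) | n :: nat. True}"
    by (simp add: dense_in_def C_def joint_orbit_closure_def)
qed

end
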